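(* Let $K\subset\mathbb{R}^k$ be compact, and let $x_\ast(\mu)\in\mathbb{R}^n$, $\mu\in K$, be an equilibrium of a smooth vector field which, under a change of coordinates $x=P_\mu(a,b)$, $(a,b)\in\mathbb{R}^{n_u+n_s}$, $n_u+n_s=n$, with $P_\mu(0,0)=x_\ast(\mu)$, takes the form $$\dot a=f^a(a,b;\mu),\qquad \dot b=f^b(a,b;\mu).\qquad(\ast)$$ Let $N$ be an $n$-dimensional $h$-set containing $x_\ast(\mu)$ whose coordinate representation is $c_N(N)=\overline{\mathbf{B}_{n_u}}\times\overline{\mathbf{B}_{n_s}}$ in the coordinates $(a,b)$ (that is, $c_N=P_\mu^{-1}$), and suppose that $N$ is an isolating block for $(\ast)$. Assume that $(f^a,f^b)^T$ satisfies the $M$-cone condition on $N\times K$ (with $M>1$), and further that $$\overrightarrow{\mu_{s,W^s}}:=\sup_{z\in N\times K}\left\{\frac{M^2+1}{M^3}\left\|\frac{\partial f^b}{\partial a}(z)\right\|+\frac1{M^2}\,m\!\left(\frac{\partial f^b}{\partial b}(z)\right)+l\!\left(\frac{\partial f^b}{\partial b}(z)\right)\right\}<0.$$ Then $$L_s(a,b;\mu):=\|\sigma^s_\mu(b)\|^2+\|b\|^2$$ is a Lyapunov function for $(\ast)$ on $W^s(x_\ast(\mu))\cap N$, where $\sigma^s_\mu$ is the Lipschitz function such that $W^s(x_\ast(\mu))\cap N=\{(\sigma^s_\mu(b),b)\mid b\in\overline{\mathbf{B}_{n_s}}\}$ (in the coordinates $(a,b)$).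
   Context: Notation. $\|\cdot\|$ is the Euclidean norm (and the induced operator norm), $\overline{\mathbf{B}_d}$ is the closed unit ball of $\mathbb{R}^d$. Points of $N$ are identified with their coordinates $(a,b)$, and derivatives of $f^a,f^b$ are taken in these coordinates. An $h$-set of dimension $n$ in $\mathbb{R}^n$ is a compact set $N$ with a homeomorphism $c_N$ such that $c_N(N)=\overline{\mathbf{B}_{n_u}}\times\overline{\mathbf{B}_{n_s}}$. For a square matrix $A$: $m(A)=\sup_{\|z\|=1}\|Az\|$; $l(A)=\lim_{h\to+0}(\|I+hA\|-1)/h$, which is the largest eigenvalue of $(A+A^T)/2$; $m_l(A)=-l(-A)$, which is the smallest eigenvalue of $(A+A^T)/2$. Isolating block: a compact set $N$ whose boundary is $N^{\rm exit}\cup N^{\rm ent}$ with $N^{\rm exit}$ closed in $\partial N$. A point $x\in\partial N$ is an exit (resp. entrance) point if for every solution $\sigma:[-\delta_1,\delta_2]\to\mathbb{R}^n$ with $\sigma(0)=x$, $\delta_1\ge0$, $\delta_2>0$, there are $0\le\epsilon_1\le\delta_1$, $0<\epsilon_2\le\delta_2$ such that $\sigma(t)\notin N$ (resp. $\sigma(t)\in{\rm int}\,N$) for $0<t\le\epsilon_2$ and $\sigma(t)\notin\partial N$ (resp. $\sigma(t)\notin N$) for $-\epsilon_1\le t<0$. $N^{\rm exit}$, $N^{\rm ent}$ are the sets of exit and entrance points. $M$-cone condition in $N\times K$ ($M>1$): with $$\overrightarrow{\mu_s}=\sup_{N\times K}\Big\{l\big(\tfrac{\partial f^b}{\partial b}\big)+M\big\|\tfrac{\partial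 f^b}{\partial(a,\mu)}\big\|\Big\},\qquad \overrightarrow{\xi_u}=\inf_{N\times K}m_l\big(\tfrac{\partial f^a}{\partial a}\big)-M\sup_{N\times K}\big\|\tfrac{\partial f^a}{\partial(b,\mu)}\big\|,$$ $$\overrightarrow{\mu_{ss}}=\sup_{N\times K}\Big\{l\big(\tfrac{\partial f^b}{\partial b}\big)+\tfrac1M\big\|\tfrac{\partial f^b}{\partial a}\big\|\Big\},\qquad \overrightarrow{\xi_{su}}=\inf_{N\times K}m_l\big(\tfrac{\partial f^a}{\partial a}\big)-\tfrac1M\sup_{N\times K}\big\|\tfrac{\partial f^a}{\partial b}\big\|,$$ one has $\overrightarrow{\mu_s}<0<\overrightarrow{\xi_u}$, $\overrightarrow{\mu_{ss}}<\overrightarrow{\xi_u}$ and $\overrightarrow{\mu_s}<\overrightarrow{\xi_{su}}$. $W^s(x_\ast(\mu))\cap N$ denotes the local stable manifold in $N$ (points whose forward orbit stays in $N$ and converges to $x_\ast(\mu)$). It is a known fact that, under the isolating block and $M$-cone hypotheses, it is the graph $a=\sigma^s_\mu(b)$ of a function $\sigma^s_\mu:\overline{\mathbf{B}_{n_s}}\to\overline{\mathbf{B}_{n_u}}$ with Lipschitz constant $1/M$. $L$ is a Lyapunov function on a set $S$ (of points of the phase space) if along the solution $x(\tau)$ through any $x=x(0)\in S$ one has $\frac{d}{d\tau}L(x(\tau))|_{\tau=0}\le0$, with equality only if $x=x_\ast(\mu)$. *)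

theory Defs
  imports "HOL-Analysis.Analysis"
begin

text \<open>Meant for open \<open>S\<close> in a finite-dimensional space: \<open>f\<close> is \<open>C\<^sup>k\<close> iff it is differentiable
  with all directional derivatives of class \<open>C\<^sup>k\<^sup>-\<^sup>1\<close>.\<close>

primrec Ck_on :: "nat \<Rightarrow> ('a::real_normed_vector \<Rightarrow> 'b::real_normed_vector) \<Rightarrow> 'a set \<Rightarrow> bool" where
  "Ck_on 0 f S \<longleftrightarrow> continuous_on S f"
| "Ck_on (Suc k) f S \<longleftrightarrow>
     (\<forall>x\<in>S. f differentiable (at x)) \<and> (\<forall>v. Ck_on k (\<lambda>x. frechet_derivative f (at x) v) S)"

definition smooth_on :: "('a::real_normed_vector \<Rightarrow> 'b::real_normed_vector) \<Rightarrow> 'a set \<Rightarrow> bool" where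
  "smooth_on f S \<longleftrightarrow> (\<forall>k. Ck_on k f S)"

definition diffeomorphism :: "('a::real_normed_vector \<Rightarrow> 'b::real_normed_vector) \<Rightarrow> bool" where
  "diffeomorphism P \<longleftrightarrow> bij P \<and> smooth_on P UNIV \<and> smooth_on (inv P) UNIV"

definition solution_on :: "('a::real_normed_vector \<Rightarrow> 'a) \<Rightarrow> real set \<Rightarrow> (real \<Rightarrow> 'a) \<Rightarrow> bool" where
  "solution_on X I x \<longleftrightarrow> (\<forall>t\<in>I. (x has_vector_derivative X (x t)) (at t within I))"

definition exit_points :: "('a::real_normed_vector \<Rightarrow> 'a) \<Rightarrow> 'a set \<Rightarrow> 'a set" where
  "exit_points X N = {p \<in> frontier N. \<forall>x d1 d2.
     0 \<le> d1 \<and> 0 < d2 \<and> solution_on X {- d1..d2} x \<and> x 0 = p \<longrightarrow>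
     (\<exists>e1 e2. 0 \<le> e1 \<and> e1 \<le> d1 \<and> 0 < e2 \<and> e2 \<le> d2 \<and>
        (\<forall>t\<in>{0<..e2}. x t \<notin> N) \<and> (\<forall>t\<in>{- e1..<0}. x t \<notin> frontier N))}"

definition entrance_points :: "('a::real_normed_vector \<Rightarrow> 'a) \<Rightarrow> 'a set \<Rightarrow> 'a set" where
  "entrance_points X N = {p \<in> frontier N. \<forall>x d1 d2.
     0 \<le> d1 \<and> 0 < d2 \<and> solution_on X {- d1..d2} x \<and> x 0 = p \<longrightarrow>
     (\<exists>e1 e2. 0 \<le> e1 \<and> e1 \<le> d1 \<and> 0 < e2 \<and> e2 \<le> d2 \<and>
        (\<forall>t\<in>{0<..e2}. x t \<in> interior N) \<and> (\<forall>t\<in>{- e1..<0}. x t \<notin> N))}"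

definition isolating_block :: "('a::real_normed_vector \<Rightarrow> 'a) \<Rightarrow> 'a set \<Rightarrow> bool" where
  "isolating_block X N \<longleftrightarrow> compact N \<and>
     frontier N = exit_points X N \<union> entrance_points X N \<and>
     closedin (top_of_set (frontier N)) (exit_points X N)"

text \<open>This is \<open>W\<^sup>s(p) \<inter> N\<close>: the points whose forward orbit stays in \<open>N\<close> and converges to \<open>p\<close>.\<close>

definition local_stable :: "('a::real_normed_vector \<Rightarrow> 'a) \<Rightarrow> 'a set \<Rightarrow> 'a \<Rightarrow> 'a set" where
  "local_stable X N p = {z. \<exists>x. solution_on X {0..} x \<and> x 0 = z \<and>
     (\<forall>t\<ge>0. x t \<in> N) \<and> (x \<longlongrightarrow> p) at_top}"

text \<open>\<open>D\<close> is the set on which \<open>L\<close> is defined.  The derivative of \<open>L\<close> along a solution is taken over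
  the times at which the solution lies in \<open>D\<close>: it is the ordinary two-sided derivative at an interior
  point of \<open>D\<close>, and the right derivative at a boundary point through which the solution
  enters \<open>D\<close>, where \<open>L\<close> has no values at earlier times.\<close>

definition lyapunov_on ::
  "('a::real_normed_vector \<Rightarrow> 'a) \<Rightarrow> 'a \<Rightarrow> 'a set \<Rightarrow> ('a \<Rightarrow> real) \<Rightarrow> 'a set \<Rightarrow> bool" where
  "lyapunov_on X p D L S \<longleftrightarrow> (\<forall>x d1 d2.
     0 \<le> d1 \<and> 0 < d2 \<and> solution_on X {- d1..d2} x \<and> x 0 \<in> S \<longrightarrow>
     (\<exists>L'. ((\<lambda>t. L (x t)) has_real_derivative L') (at 0 within {t \<in> {- d1..d2}. x t \<in> D}) \<and>
        L' \<le> 0 \<and> (L' = 0 \<longrightarrow> x 0 = p)))"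

definition h_set :: "'a::real_normed_vector set \<Rightarrow>
    ('a \<Rightarrow> 'u::real_normed_vector \<times> 's::real_normed_vector) \<Rightarrow> bool" where
  "h_set N c \<longleftrightarrow> compact N \<and> (\<exists>g. homeomorphism N (cball 0 1 \<times> cball 0 1) c g)"

text \<open>Matrices are represented by linear maps and the operator norm is \<open>onorm\<close> (the library's norm
  on the matrix type is not the operator norm).\<close>

definition mat_m :: "('a::euclidean_space \<Rightarrow> 'a) \<Rightarrow> real" where
  "mat_m A = (SUP z\<in>{z. norm z = 1}. norm (A z))"

definition log_norm :: "('a::euclidean_space \<Rightarrow> 'a) \<Rightarrow> real" where
  "log_norm A = Lim (at_right 0) (\<lambda>h::real. (onorm (\<lambda>z. z + h *\<^sub>R A z) - 1) / h)"

definition log_min :: "('a::euclidean_space \<Rightarrow> 'a) \<Rightarrow> real" where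
  "log_min A = - log_norm (\<lambda>z. - A z)"

definition D_a :: "('u::euclidean_space \<Rightarrow> 's::euclidean_space \<Rightarrow> 'k::euclidean_space \<Rightarrow>
    'c::euclidean_space) \<Rightarrow> 'u \<Rightarrow> 's \<Rightarrow> 'k \<Rightarrow> 'u \<Rightarrow> 'c" where
  "D_a f a b \<mu> = frechet_derivative (\<lambda>a'. f a' b \<mu>) (at a)"

definition D_b :: "('u::euclidean_space \<Rightarrow> 's::euclidean_space \<Rightarrow> 'k::euclidean_space \<Rightarrow>
    'c::euclidean_space) \<Rightarrow> 'u \<Rightarrow> 's \<Rightarrow> 'k \<Rightarrow> 's \<Rightarrow> 'c" where
  "D_b f a b \<mu> = frechet_derivative (\<lambda>b'. f a b' \<mu>) (at b)"

definition D_a\<mu> :: "('u::euclidean_space \<Rightarrow> 's::euclidean_space \<Rightarrow> 'k::euclidean_space \<Rightarrow>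
    'c::euclidean_space) \<Rightarrow> 'u \<Rightarrow> 's \<Rightarrow> 'k \<Rightarrow> 'u \<times> 'k \<Rightarrow> 'c" where
  "D_a\<mu> f a b \<mu> = frechet_derivative (\<lambda>(a', \<mu>'). f a' b \<mu>') (at (a, \<mu>))"

definition D_b\<mu> :: "('u::euclidean_space \<Rightarrow> 's::euclidean_space \<Rightarrow> 'k::euclidean_space \<Rightarrow>
    'c::euclidean_space) \<Rightarrow> 'u \<Rightarrow> 's \<Rightarrow> 'k \<Rightarrow> 's \<times> 'k \<Rightarrow> 'c" where
  "D_b\<mu> f a b \<mu> = frechet_derivative (\<lambda>(b', \<mu>'). f a b' \<mu>') (at (b, \<mu>))"

text \<open>In the following, \<open>B\<close> is the coordinate representation of \<open>N\<close>.  The real-valued suprema and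
  infima below are meaningful because the expressions are bounded on the compact set \<open>B \<times> K\<close>.\<close>

definition mu_s :: "('u::euclidean_space \<Rightarrow> 's::euclidean_space \<Rightarrow> 'k::euclidean_space \<Rightarrow> 's) \<Rightarrow>
    real \<Rightarrow> ('u \<times> 's) set \<Rightarrow> 'k set \<Rightarrow> real" where
  "mu_s fb M B K = (SUP ((a, b), \<mu>)\<in>B \<times> K. log_norm (D_b fb a b \<mu>) + M * onorm (D_a\<mu> fb a b \<mu>))"

definition xi_u :: "('u::euclidean_space \<Rightarrow> 's::euclidean_space \<Rightarrow> 'k::euclidean_space \<Rightarrow> 'u) \<Rightarrow>
    real \<Rightarrow> ('u \<times> 's) set \<Rightarrow> 'k set \<Rightarrow> real" where
  "xi_u fa M B K = (INF ((a, b), \<mu>)\<in>B \<times> K. log_min (D_a fa a b \<mu>))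
     - M * (SUP ((a, b), \<mu>)\<in>B \<times> K. onorm (D_b\<mu> fa a b \<mu>))"

definition mu_ss :: "('u::euclidean_space \<Rightarrow> 's::euclidean_space \<Rightarrow> 'k::euclidean_space \<Rightarrow> 's) \<Rightarrow>
    real \<Rightarrow> ('u \<times> 's) set \<Rightarrow> 'k set \<Rightarrow> real" where
  "mu_ss fb M B K = (SUP ((a, b), \<mu>)\<in>B \<times> K. log_norm (D_b fb a b \<mu>) + 1 / M * onorm (D_a fb a b \<mu>))"

definition xi_su :: "('u::euclidean_space \<Rightarrow> 's::euclidean_space \<Rightarrow> 'k::euclidean_space \<Rightarrow> 'u) \<Rightarrow>
    real \<Rightarrow> ('u \<times> 's) set \<Rightarrow> 'k set \<Rightarrow> real" where
  "xi_su fa M B K = (INF ((a, b), \<mu>)\<in>B \<times> K. log_min (D_a fa a b \<mu>))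
     - 1 / M * (SUP ((a, b), \<mu>)\<in>B \<times> K. onorm (D_b fa a b \<mu>))"

definition cone_condition ::
  "('u::euclidean_space \<Rightarrow> 's::euclidean_space \<Rightarrow> 'k::euclidean_space \<Rightarrow> 'u) \<Rightarrow>
   ('u \<Rightarrow> 's \<Rightarrow> 'k \<Rightarrow> 's) \<Rightarrow> real \<Rightarrow> ('u \<times> 's) set \<Rightarrow> 'k set \<Rightarrow> bool" where
  "cone_condition fa fb M B K \<longleftrightarrow>
     mu_s fb M B K < 0 \<and> 0 < xi_u fa M B K \<and>
     mu_ss fb M B K < xi_u fa M B K \<and> mu_s fb M B K < xi_su fa M B K"

definition mu_s_Ws :: "('u::euclidean_space \<Rightarrow> 's::euclidean_space \<Rightarrow> 'k::euclidean_space \<Rightarrow> 's) \<Rightarrow>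
    real \<Rightarrow> ('u \<times> 's) set \<Rightarrow> 'k set \<Rightarrow> real" where
  "mu_s_Ws fb M B K = (SUP ((a, b), \<mu>)\<in>B \<times> K.
     (M^2 + 1) / M^3 * onorm (D_a fb a b \<mu>) + 1 / M^2 * mat_m (D_b fb a b \<mu>) + log_norm (D_b fb a b \<mu>))"

definition coord_field :: "('u \<Rightarrow> 's \<Rightarrow> 'k \<Rightarrow> 'u) \<Rightarrow> ('u \<Rightarrow> 's \<Rightarrow> 'k \<Rightarrow> 's) \<Rightarrow> 'k \<Rightarrow> 'u \<times> 's \<Rightarrow> 'u \<times> 's" where
  "coord_field fa fb \<mu> = (\<lambda>(a, b). (fa a b \<mu>, fb a b \<mu>))"

end

theory Submission
  imports Defs
begin

text \<open>Two solutions that stay in \<open>B\<close> and whose difference leaves the cone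
  \<open>\<parallel>\<Delta>a\<parallel> \<le> \<parallel>\<Delta>b\<parallel> / M\<close> separate in the unstable direction, so the points of the local stable set differ
  by vectors of this cone, and so do the velocities there: \<open>\<parallel>f\<^sup>a\<parallel> \<le> \<parallel>f\<^sup>b\<parallel> / M\<close>.  Along a solution in
  the stable set \<open>L\<close> coincides with \<open>\<parallel>a\<parallel>\<^sup>2 + \<parallel>b\<parallel>\<^sup>2\<close>, and half its derivative
  \<open>a \<bullet> f\<^sup>a + b \<bullet> f\<^sup>b\<close> is at most \<open>\<parallel>b\<parallel> \<parallel>f\<^sup>b\<parallel> / M\<^sup>2 + b \<bullet> f\<^sup>b\<close>, which the rate hypothesis bounds by a negative
  multiple of \<open>\<parallel>b\<parallel>\<^sup>2\<close>.\<close>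

section \<open>Logarithmic norms\<close>

text \<open>The function \<open>\<sigma>\<close> enters only through its graph, so \<open>L\<close>
  cannot be differentiated as a function of b; everything is read off from solution curves. Write
  \<Delta>a, \<Delta>b for the components of a difference of two solutions. Where ||\<Delta>b||
  \<le> M ||\<Delta>a||, the cross term ||df^b/da|| ||\<Delta>a|| ||\<Delta>b|| can exceed what the
  weight 1/M in \<open>mu_ss\<close> pays for. The excess carries the factor ||\<Delta>a|| -
  ||\<Delta>b||/M, which vanishes on the boundary of that region, so it is absorbed by a multiple of
  V = ||\<Delta>a||^2 - ||\<Delta>b||^2/M^2. This leaves V' \<ge> c V with c of unknown sign: enough
  to keep V positive, while \<open>0 < xi_u\<close> keeps ||\<Delta>a|| from shrinking. A second
  obstacle is that \<open>mu_ss\<close> and \<open>mu_s_Ws\<close> are suprema of sums, so their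
  summands must be evaluated at one common point, although vector-valued maps have no mean value
  theorem with equality. Pairing with one fixed vector restores it. Finally, the derivative of
  \<open>L\<close> along a solution may involve earlier times, so points just before time 0 that lie
  in \<open>B\<close> must be shown to be in the stable set as well.\<close>

lemma onorm_ge_inner:
  fixes A :: "'a::euclidean_space \<Rightarrow> 'a"
  assumes "linear A" "h > 0"
  shows "z \<bullet> A z \<le> (onorm (\<lambda>z. z + h *\<^sub>R A z) - 1) / h * (norm z)\<^sup>2"
proof -
  have bl: "bounded_linear (\<lambda>z. z + h *\<^sub>R A z)"
    using assms(1) by (intro bounded_linear_add bounded_linear_ident
        bounded_linear_scaleR_right[THEN bounded_linear_compose] linear_conv_bounded_linear[THEN iffD1])
  have "z \<bullet> (z + h *\<^sub>R A z) \<le> norm z * norm (z + h *\<^sub>R A z)"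
    by (rule norm_cauchy_schwarz)
  also have "\<dots> \<le> norm z * (onorm (\<lambda>z. z + h *\<^sub>R A z) * norm z)"
    by (intro mult_left_mono onorm[OF bl]) auto
  finally have "h * (z \<bullet> A z) \<le> (onorm (\<lambda>z. z + h *\<^sub>R A z) - 1) * (norm z)\<^sup>2"
    by (simp add: algebra_simps dot_square_norm power2_eq_square)
  then show ?thesis using assms(2) by (simp add: field_simps)
qed

text \<open>The triangle inequality in both directions around the identity, whose norm is 1. The
  bound does not depend on \<open>h\<close>, so it bounds the quotients from below and survives the
  limit.\<close>

lemma onorm_ident_add_bounds:
  fixes A :: "'a::euclidean_space \<Rightarrow> 'a"
  assumes "linear A" "h > 0"
  shows "\<bar>(onorm (\<lambda>z. z + h *\<^sub>R A z) - 1) / h\<bar> \<le> onorm A"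
proof -
  have blA: "bounded_linear A" using assms(1) by (simp add: linear_conv_bounded_linear)
  have bl: "bounded_linear (\<lambda>z. z + h *\<^sub>R A z)"
    by (intro bounded_linear_add bounded_linear_ident
        bounded_linear_scaleR_right[THEN bounded_linear_compose] blA)
  have blh: "bounded_linear (\<lambda>z. h *\<^sub>R A z)"
    by (intro bounded_linear_scaleR_right[THEN bounded_linear_compose] blA)
  have id1: "onorm (\<lambda>z::'a. z) = 1"
    by (rule onorm_id)
  have hA: "onorm (\<lambda>z. h *\<^sub>R A z) = h * onorm A"
    using onorm_scaleR[OF blA, of h] assms(2) by simp
  have "onorm (\<lambda>z. z + h *\<^sub>R A z) \<le> 1 + h * onorm A"
    using onorm_triangle[OF bounded_linear_ident blh] id1 hA by simp
  moreover have "1 \<le> onorm (\<lambda>z. z + h *\<^sub>R A z) + h * onorm A"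
    using onorm_triangle[OF bl bounded_linear_minus[OF blh]] id1 hA
      onorm_neg[of "\<lambda>z. h *\<^sub>R A z"] by simp
  ultimately have "\<bar>onorm (\<lambda>z. z + h *\<^sub>R A z) - 1\<bar> \<le> onorm A * h"
    by (simp add: abs_le_iff algebra_simps)
  then show ?thesis using assms(2) by (simp add: abs_divide pos_divide_le_eq)
qed

text \<open>Convexity of the norm makes the quotient monotone in \<open>h\<close>, so that it converges to its infimum.\<close>

lemma log_norm_tendsto:
  fixes A :: "'a::euclidean_space \<Rightarrow> 'a"
  assumes "linear A"
  shows "((\<lambda>h. (onorm (\<lambda>z. z + h *\<^sub>R A z) - 1) / h) \<longlongrightarrow> log_norm A) (at_right 0)"
proof -
  define q where "q h = (onorm (\<lambda>z. z + h *\<^sub>R A z) - 1) / h" for h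
  have blA: "bounded_linear A" using assms(1) by (simp add: linear_conv_bounded_linear)
  have bl: "bounded_linear (\<lambda>z. z + h *\<^sub>R A z)" for h
    by (intro bounded_linear_add bounded_linear_ident
        bounded_linear_scaleR_right[THEN bounded_linear_compose] blA)
  have id1: "onorm (\<lambda>z::'a. z) = 1"
    by (rule onorm_id)
  have mono: "q h \<le> q k" if "0 < h" "h \<le> k" for h k
  proof -
    \<comment> \<open>With this \<open>c\<close>, I + hA is the convex combination (1 - c) I + c (I
      + kA).\<close>
    define c where "c = h / k"
    have c: "0 < c" "c \<le> 1" "h = c * k" using that by (auto simp: c_def)
    have eq: "(\<lambda>z. z + h *\<^sub>R A z) = (\<lambda>z. (1 - c) *\<^sub>R z + c *\<^sub>R (z + k *\<^sub>R A z))"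
      by (auto simp: c(3) algebra_simps)
    have "onorm (\<lambda>z. z + h *\<^sub>R A z) \<le> onorm (\<lambda>z::'a. (1 - c) *\<^sub>R z) + onorm (\<lambda>z. c *\<^sub>R (z + k *\<^sub>R A z))"
      unfolding eq by (intro onorm_triangle bounded_linear_scaleR_right
          bounded_linear_scaleR_right[THEN bounded_linear_compose] bl)
    also have "\<dots> = (1 - c) + c * onorm (\<lambda>z. z + k *\<^sub>R A z)"
      using onorm_scaleR[OF bounded_linear_ident, of "1 - c", where 'b='a] onorm_scaleR[OF bl, of c k] c id1 by simp
    finally have "onorm (\<lambda>z. z + h *\<^sub>R A z) - 1 \<le> c * (onorm (\<lambda>z. z + k *\<^sub>R A z) - 1)"
      by (simp add: algebra_simps)
    then have "q h \<le> c * (onorm (\<lambda>z. z + k *\<^sub>R A z) - 1) / h"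
      unfolding q_def using that by (intro divide_right_mono) auto
    also have "\<dots> = q k" unfolding q_def using that by (simp add: c_def)
    finally show ?thesis .
  qed
  have bdd: "bdd_below (q ` {0<..})"
  proof (rule bdd_belowI2)
    show "- onorm A \<le> q h" if "h \<in> {0<..}" for h
      using abs_le_D2[OF onorm_ident_add_bounds[OF assms, of h]] that unfolding q_def greaterThan_iff by linarith
  qed
  have lim: "(q \<longlongrightarrow> Inf (q ` {0<..})) (at_right 0)"
  proof (rule order_tendstoI)
    fix a assume "a < Inf (q ` {0<..})"
    then have "a < q h" if "h > 0" for h
      using cINF_lower[OF bdd, of h] that by auto
    then show "eventually (\<lambda>h. a < q h) (at_right 0)"
      by (auto simp: eventually_at_filter)
  next
    fix a assume "Inf (q ` {0<..}) < a"
    then obtain k where k: "k > 0" "q k < a"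
      using cINF_less_iff[OF _ bdd, of a] by auto
    have "eventually (\<lambda>h. h \<in> {0<..<k}) (at_right 0)"
      using k eventually_at_right_field by auto
    then show "eventually (\<lambda>h. q h < a) (at_right 0)"
      by eventually_elim (meson mono k(2) greaterThanLessThan_iff le_less_trans less_imp_le)
  qed
  \<comment> \<open>\<open>Lim\<close> is a definite description, so the definition of
    \<open>log_norm\<close> gives nothing until convergence is known.\<close>
  then have "log_norm A = Inf (q ` {0<..})"
    unfolding log_norm_def q_def[symmetric] by (intro tendsto_Lim) auto
  with lim show ?thesis unfolding q_def by simp
qed

text \<open>The limit h -> 0+ of \<open>onorm_ge_inner\<close>. It replaces the description of
  \<open>log_norm A\<close> as the largest eigenvalue of (A + A^T)/2: only this bound on the
  quadratic form is used.\<close>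

lemma inner_le_log_norm:
  fixes A :: "'a::euclidean_space \<Rightarrow> 'a"
  assumes "linear A"
  shows "z \<bullet> A z \<le> log_norm A * (norm z)\<^sup>2"
proof (rule tendsto_le[OF _ tendsto_mult_right[OF log_norm_tendsto[OF assms]] tendsto_const])
  show "eventually (\<lambda>h. z \<bullet> A z \<le> (onorm (\<lambda>z. z + h *\<^sub>R A z) - 1) / h * (norm z)\<^sup>2) (at_right 0)"
    using onorm_ge_inner[OF assms, of _ z] by (auto simp: eventually_at_filter)
qed auto

lemma abs_log_norm_le_onorm:
  fixes A :: "'a::euclidean_space \<Rightarrow> 'a"
  assumes "linear A"
  shows "\<bar>log_norm A\<bar> \<le> onorm A"
proof (rule tendsto_le[OF _ tendsto_const tendsto_rabs[OF log_norm_tendsto[OF assms]]])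
  show "eventually (\<lambda>h. \<bar>(onorm (\<lambda>z. z + h *\<^sub>R A z) - 1) / h\<bar> \<le> onorm A) (at_right 0)"
    using onorm_ident_add_bounds[OF assms] by (auto simp: eventually_at_filter)
qed auto

lemma log_min_le_inner:
  fixes A :: "'a::euclidean_space \<Rightarrow> 'a"
  assumes "linear A"
  shows "log_min A * (norm z)\<^sup>2 \<le> z \<bullet> A z"
  using inner_le_log_norm[OF linear_compose_neg[OF assms], of z] by (simp add: log_min_def)

lemma abs_log_min_le_onorm:
  fixes A :: "'a::euclidean_space \<Rightarrow> 'a"
  assumes "linear A"
  shows "\<bar>log_min A\<bar> \<le> onorm A"
  using abs_log_norm_le_onorm[OF linear_compose_neg[OF assms]] by (simp add: log_min_def onorm_neg)

lemma
  fixes A :: "'a::euclidean_space \<Rightarrow> 'a"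
  assumes "linear A"
  shows norm_le_mat_m: "norm (A z) \<le> mat_m A * norm z"
    and mat_m_le_onorm: "mat_m A \<le> onorm A"
proof -
  have bl: "bounded_linear A" using assms by (simp add: linear_conv_bounded_linear)
  have le: "norm (A z) \<le> onorm A" if "norm z = 1" for z
    using onorm[OF bl, of z] that by simp
  have "\<exists>z::'a. norm z = 1" using vector_choose_size[of 1] by (metis zero_le_one)
  then show "mat_m A \<le> onorm A"
    unfolding mat_m_def using le by (intro cSUP_least) auto
  show "norm (A z) \<le> mat_m A * norm z"
  proof (cases "z = 0")
    case True
    then show ?thesis using linear_0[OF assms] by simp
  next
    case False
    have "norm (A (z /\<^sub>R norm z)) \<le> mat_m A"
      unfolding mat_m_def using le False by (intro cSUP_upper bdd_aboveI2[where M = "onorm A"]) auto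
    then show ?thesis
      using False by (simp add: linear_scale[OF assms] divide_simps mult.commute)
  qed
qed

section \<open>Partial derivatives of smooth maps\<close>

lemma smooth_on_differentiable:
  assumes "smooth_on f S" "x \<in> S"
  shows "f differentiable (at x)"
  using assms(1)[unfolded smooth_on_def, rule_format, of "Suc 0"] assms(2) by simp

text \<open>\<open>Ck_on\<close> yields continuity of the derivative one direction at a time. The
  sum of the norms over the basis directions is continuous, hence bounded on \<open>C\<close>, and
  dominates the operator norm.\<close>

lemma smooth_on_onorm_bound:
  fixes f :: "'a::euclidean_space \<Rightarrow> 'b::real_normed_vector"
  assumes "smooth_on f S" "compact C" "C \<subseteq> S"
  shows "\<exists>c\<ge>0. \<forall>z\<in>C. onorm (frechet_derivative f (at z)) \<le> c"
proof -
  let ?D = "\<lambda>z. frechet_derivative f (at z)"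
  have cont: "continuous_on S (\<lambda>z. ?D z v)" for v
    using assms(1)[unfolded smooth_on_def, rule_format, of "Suc 0"] by simp
  have "compact ((\<lambda>z. \<Sum>i\<in>Basis. norm (?D z i)) ` C)"
    by (intro compact_continuous_image continuous_intros continuous_on_subset[OF cont] assms)
  then obtain c where "\<forall>x\<in>(\<lambda>z. \<Sum>i\<in>Basis. norm (?D z i)) ` C. norm x \<le> c"
    using compact_imp_bounded bounded_iff by blast
  then have c: "(\<Sum>i\<in>Basis. norm (?D z i)) \<le> c" if "z \<in> C" for z
    using that by fastforce
  have "onorm (?D z) \<le> max 0 c" if z: "z \<in> C" for z
  proof (rule onorm_bound)
    fix v :: 'a
    have lin: "linear (?D z)"
      using smooth_on_differentiable[OF assms(1)] z assms(3) by (auto intro: linear_frechet_derivative)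
    have "?D z v = ?D z (\<Sum>i\<in>Basis. (v \<bullet> i) *\<^sub>R i)" by (simp only: euclidean_representation)
    also have "\<dots> = (\<Sum>i\<in>Basis. (v \<bullet> i) *\<^sub>R ?D z i)"
      by (simp only: linear_sum[OF lin] linear_scale[OF lin])
    also have "norm \<dots> \<le> (\<Sum>i\<in>Basis. norm v * norm (?D z i))"
      by (rule sum_norm_le) (auto intro!: mult_right_mono simp: Basis_le_norm)
    also have "\<dots> \<le> max 0 c * norm v"
    proof -
      have "(\<Sum>i\<in>Basis. norm v * norm (?D z i)) = (\<Sum>i\<in>Basis. norm (?D z i)) * norm v"
        by (simp only: sum_distrib_left[symmetric] mult.commute)
      also have "\<dots> \<le> max 0 c * norm v" using c[OF z] by (intro mult_right_mono) auto
      finally show ?thesis .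
    qed
    finally show "norm (?D z v) \<le> max 0 c * norm v" .
  qed auto
  then show ?thesis by (intro exI[of _ "max 0 c"]) simp
qed

text \<open>The target type is left free so that both \<open>fa\<close> and \<open>fb\<close> are
  instances.\<close>

locale smooth_family =
  fixes f :: "'u::euclidean_space \<Rightarrow> 's::euclidean_space \<Rightarrow> 'k::euclidean_space \<Rightarrow> 'c::euclidean_space"
    and \<Lambda> :: "'k set"
  assumes smooth: "smooth_on (\<lambda>((a, b), \<mu>). f a b \<mu>) (UNIV \<times> \<Lambda>)"
begin

definition J where "J a b \<mu> = frechet_derivative (\<lambda>((a, b), \<mu>). f a b \<mu>) (at ((a, b), \<mu>))"

lemma has_derivative_J:
  assumes "\<mu> \<in> \<Lambda>"
  shows "((\<lambda>p. f (fst (fst p)) (snd (fst p)) (snd p)) has_derivative J a b \<mu>) (at ((a, b), \<mu>))"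
  using smooth_on_differentiable[OF smooth, of "((a, b), \<mu>)"] assms
  unfolding J_def frechet_derivative_works case_prod_unfold by simp

lemma bounded_linear_J: "\<mu> \<in> \<Lambda> \<Longrightarrow> bounded_linear (J a b \<mu>)"
  by (rule has_derivative_bounded_linear[OF has_derivative_J])

text \<open>Each partial derivative is taken along an affine embedding of its variables, so the
  chain rule and uniqueness of derivatives turn it into a restriction of the one total derivative
  \<open>J\<close>.\<close>

lemma partials:
  assumes "\<mu> \<in> \<Lambda>"
  shows "D_a f a b \<mu> = (\<lambda>u. J a b \<mu> ((u, 0), 0))"
    and "D_b f a b \<mu> = (\<lambda>v. J a b \<mu> ((0, v), 0))"
    and "D_b\<mu> f a b \<mu> = (\<lambda>p. J a b \<mu> ((0, fst p), snd p))"
proof -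
  note D = has_derivative_J[OF assms, of a b]
  have "((\<lambda>a'. ((a', b), \<mu>)) has_derivative (\<lambda>u. ((u, 0), 0))) (at a)"
    by (auto intro!: derivative_eq_intros)
  from has_derivative_compose[OF this D]
  have "((\<lambda>a'. f a' b \<mu>) has_derivative (\<lambda>u. J a b \<mu> ((u, 0), 0))) (at a)"
    unfolding fst_conv snd_conv .
  then show "D_a f a b \<mu> = (\<lambda>u. J a b \<mu> ((u, 0), 0))"
    unfolding D_a_def by (rule frechet_derivative_at[symmetric])
  have "((\<lambda>b'. ((a, b'), \<mu>)) has_derivative (\<lambda>v. ((0, v), 0))) (at b)"
    by (auto intro!: derivative_eq_intros)
  from has_derivative_compose[OF this D]
  have "((\<lambda>b'. f a b' \<mu>) has_derivative (\<lambda>v. J a b \<mu> ((0, v), 0))) (at b)"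
    unfolding fst_conv snd_conv .
  then show "D_b f a b \<mu> = (\<lambda>v. J a b \<mu> ((0, v), 0))"
    unfolding D_b_def by (rule frechet_derivative_at[symmetric])
  have "((\<lambda>p. ((a, fst p), snd p)) has_derivative (\<lambda>p. ((0, fst p), snd p))) (at (b, \<mu>))"
    by (auto intro!: derivative_eq_intros)
  from has_derivative_compose[OF this] D
  have "((\<lambda>p. f a (fst p) (snd p)) has_derivative (\<lambda>p. J a b \<mu> ((0, fst p), snd p))) (at (b, \<mu>))"
    by fastforce
  then show "D_b\<mu> f a b \<mu> = (\<lambda>p. J a b \<mu> ((0, fst p), snd p))"
    unfolding D_b\<mu>_def case_prod_unfold by (rule frechet_derivative_at[symmetric])
qed

lemma bounded_linear_partials:
  assumes "\<mu> \<in> \<Lambda>"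
  shows "bounded_linear (D_a f a b \<mu>)" "bounded_linear (D_b f a b \<mu>)" "bounded_linear (D_b\<mu> f a b \<mu>)"
proof -
  note bl = bounded_linear_compose[OF bounded_linear_J[OF assms]]
  show "bounded_linear (D_a f a b \<mu>)"
    unfolding partials[OF assms]
    by (intro bl bounded_linear_Pair bounded_linear_ident bounded_linear_zero)
  show "bounded_linear (D_b f a b \<mu>)"
    unfolding partials[OF assms]
    by (intro bl bounded_linear_Pair bounded_linear_ident bounded_linear_zero)
  show "bounded_linear (D_b\<mu> f a b \<mu>)"
    unfolding partials[OF assms]
    by (intro bl bounded_linear_Pair bounded_linear_fst bounded_linear_snd bounded_linear_zero)
qed

text \<open>Restricting a linear map along an isometric embedding cannot increase its norm. The last
  inequality lets \<open>xi_u\<close>, which involves the derivative in (b, \<mu>), control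
  differences at a fixed parameter.\<close>

lemma onorm_partials_le:
  assumes "\<mu> \<in> \<Lambda>"
  shows "onorm (D_a f a b \<mu>) \<le> onorm (J a b \<mu>)"
    and "onorm (D_b f a b \<mu>) \<le> onorm (J a b \<mu>)"
    and "onorm (D_b\<mu> f a b \<mu>) \<le> onorm (J a b \<mu>)"
    and "onorm (D_b f a b \<mu>) \<le> onorm (D_b\<mu> f a b \<mu>)"
proof -
  note bl = bounded_linear_J[OF assms, of a b]
  show "onorm (D_a f a b \<mu>) \<le> onorm (J a b \<mu>)"
    unfolding partials[OF assms]
  proof (rule onorm_bound[OF onorm_pos_le[OF bl]])
    fix u
    show "norm (J a b \<mu> ((u, 0), 0)) \<le> onorm (J a b \<mu>) * norm u"
      using onorm[OF bl, of "((u, 0), 0)"] by (simp add: norm_Pair)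
  qed
  show "onorm (D_b f a b \<mu>) \<le> onorm (J a b \<mu>)"
    unfolding partials[OF assms]
  proof (rule onorm_bound[OF onorm_pos_le[OF bl]])
    fix v
    show "norm (J a b \<mu> ((0, v), 0)) \<le> onorm (J a b \<mu>) * norm v"
      using onorm[OF bl, of "((0, v), 0)"] by (simp add: norm_Pair)
  qed
  show "onorm (D_b\<mu> f a b \<mu>) \<le> onorm (J a b \<mu>)"
    unfolding partials[OF assms]
  proof (rule onorm_bound[OF onorm_pos_le[OF bl]])
    fix p :: "'s \<times> 'k"
    have "norm ((0::'u, fst p), snd p) = norm p" by (cases p) (simp add: norm_Pair)
    then show "norm (J a b \<mu> ((0, fst p), snd p)) \<le> onorm (J a b \<mu>) * norm p"
      using onorm[OF bl, of "((0, fst p), snd p)"] by simp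
  qed
  note bl' = bounded_linear_partials(3)[OF assms, of a b]
  show "onorm (D_b f a b \<mu>) \<le> onorm (D_b\<mu> f a b \<mu>)"
  proof (rule onorm_bound[OF onorm_pos_le[OF bl']])
    fix v
    have "D_b f a b \<mu> v = D_b\<mu> f a b \<mu> (v, 0)" unfolding partials[OF assms] by simp
    then show "norm (D_b f a b \<mu> v) \<le> onorm (D_b\<mu> f a b \<mu>) * norm v"
      using onorm[OF bl', of "(v, 0)"] by (simp add: norm_Pair)
  qed
qed

lemma has_derivative_slice:
  assumes "\<mu> \<in> \<Lambda>"
  shows "((\<lambda>z. f (fst z) (snd z) \<mu>) has_derivative
    (\<lambda>z. J a b \<mu> (z, 0))) (at (a, b))"
proof -
  have "((\<lambda>z. (z, \<mu>)) has_derivative (\<lambda>z. (z, 0))) (at (a, b))"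
    by (auto intro!: derivative_eq_intros)
  from has_derivative_compose[OF this has_derivative_J[OF assms, of a b]]
  show ?thesis unfolding fst_conv snd_conv .
qed

lemma J_split:
  assumes "\<mu> \<in> \<Lambda>"
  shows "J a b \<mu> ((u, v), 0) = D_a f a b \<mu> u + D_b f a b \<mu> v"
  using linear_add[OF bounded_linear.linear[OF bounded_linear_J[OF assms, of a b]], of "((u, 0), 0)" "((0, v), 0)"]
  unfolding partials[OF assms] by simp

text \<open>Pairing with the fixed vector \<open>w\<close> reduces to the scalar mean value theorem
  on the segment. Both partial derivatives then appear at the same intermediate point.\<close>

lemma inner_mean_value:
  assumes "\<mu> \<in> \<Lambda>"
  obtains a b where "(a, b) \<in> closed_segment (a0, b0) (a1, b1)"
    "w \<bullet> (f a1 b1 \<mu> - f a0 b0 \<mu>) = w \<bullet> (D_a f a b \<mu> (a1 - a0) + D_b f a b \<mu> (b1 - b0))"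
proof -
  define z where "z t = (a0 + t *\<^sub>R (a1 - a0), b0 + t *\<^sub>R (b1 - b0))" for t :: real
  define g where "g t = w \<bullet> f (fst (z t)) (snd (z t)) \<mu>" for t
  have "\<exists>t\<in>{0<..<1}. g 1 - g 0 = (\<lambda>s. w \<bullet> J (fst (z t)) (snd (z t)) \<mu> (s *\<^sub>R (a1 - a0, b1 - b0), 0)) (1 - 0)"
  proof (rule mvt_simple)
    fix t :: real
    have "(z has_derivative (\<lambda>s. s *\<^sub>R (a1 - a0, b1 - b0))) (at t within {0..1})"
      unfolding z_def[abs_def] by (auto intro!: derivative_eq_intros)
    from has_derivative_inner_right[OF has_derivative_compose[OF this
          has_derivative_slice[OF assms, of "fst (z t)" "snd (z t)", unfolded prod.collapse]], of w]
    show "(g has_derivative (\<lambda>s. w \<bullet> J (fst (z t)) (snd (z t)) \<mu> (s *\<^sub>R (a1 - a0, b1 - b0), 0))) (at t within {0..1})"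
      unfolding g_def by simp
  qed simp
  then obtain t where t: "0 < t" "t < 1"
    "g 1 - g 0 = w \<bullet> J (fst (z t)) (snd (z t)) \<mu> ((a1 - a0, b1 - b0), 0)" by auto
  show thesis
  proof (rule that[of "fst (z t)" "snd (z t)"])
    show "(fst (z t), snd (z t)) \<in> closed_segment (a0, b0) (a1, b1)"
      unfolding in_segment using t by (intro exI[of _ t]) (auto simp: z_def algebra_simps)
    show "w \<bullet> (f a1 b1 \<mu> - f a0 b0 \<mu>) =
      w \<bullet> (D_a f (fst (z t)) (snd (z t)) \<mu> (a1 - a0) + D_b f (fst (z t)) (snd (z t)) \<mu> (b1 - b0))"
      using t(3) unfolding J_split[OF assms] by (simp add: g_def z_def inner_diff_right)
  qed
qed

lemma onorm_J_bound:
  assumes "compact C" "compact K" "K \<subseteq> \<Lambda>"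
  shows "\<exists>c\<ge>0. \<forall>a b \<mu>. (a, b) \<in> C \<longrightarrow> \<mu> \<in> K \<longrightarrow> onorm (J a b \<mu>) \<le> c"
proof -
  have "compact (C \<times> K)" "C \<times> K \<subseteq> UNIV \<times> \<Lambda>" using assms by (auto intro: compact_Times)
  from smooth_on_onorm_bound[OF smooth this] show ?thesis
    unfolding J_def by (meson SigmaI)
qed

text \<open>The input for uniqueness of solutions. Arbitrary balls are needed because a solution may
  leave the block.\<close>

lemma lipschitz_on_slice:
  assumes "\<mu> \<in> \<Lambda>"
  shows "\<exists>L\<ge>0. \<forall>z z'. norm z \<le> R \<longrightarrow> norm z' \<le> R \<longrightarrow>
    norm (f (fst z) (snd z) \<mu> - f (fst z') (snd z') \<mu>) \<le> L * norm (z - z')"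
proof -
  have "compact {\<mu>}" "{\<mu>} \<subseteq> \<Lambda>" using assms by simp_all
  from onorm_J_bound[OF compact_cball[of 0 R] this] obtain c where
    c: "c \<ge> 0" "\<And>a b. (a, b) \<in> cball 0 R \<Longrightarrow> onorm (J a b \<mu>) \<le> c"
    by auto
  have "norm (f (fst z) (snd z) \<mu> - f (fst z') (snd z') \<mu>) \<le> c * norm (z - z')"
    if "norm z \<le> R" "norm z' \<le> R" for z z'
  proof (rule differentiable_bound[of "cball 0 R"])
    fix y :: "'u \<times> 's" assume y: "y \<in> cball 0 R"
    show "((\<lambda>z. f (fst z) (snd z) \<mu>) has_derivative (\<lambda>z. J (fst y) (snd y) \<mu> (z, 0))) (at y within cball 0 R)"
      using has_derivative_slice[OF assms, of "fst y" "snd y"] by (auto intro: has_derivative_at_withinI)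
    have bl: "bounded_linear (J (fst y) (snd y) \<mu>)" by (rule bounded_linear_J[OF assms])
    show "onorm (\<lambda>z. J (fst y) (snd y) \<mu> (z, 0)) \<le> c"
    proof (rule onorm_bound[OF c(1)])
      fix z :: "'u \<times> 's"
      have "norm (J (fst y) (snd y) \<mu> (z, 0)) \<le> onorm (J (fst y) (snd y) \<mu>) * norm z"
        using onorm[OF bl, of "(z, 0)"] by (simp add: norm_Pair)
      also have "\<dots> \<le> c * norm z" using c(2)[of "fst y" "snd y"] y by (intro mult_right_mono) auto
      finally show "norm (J (fst y) (snd y) \<mu> (z, 0)) \<le> c * norm z" .
    qed
  qed (use that in auto)
  with c(1) show ?thesis by blast
qed

end

section \<open>Solutions in coordinates\<close>

lemma has_real_derivative_norm_power2:
  fixes x :: "real \<Rightarrow> 'a::real_inner"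
  assumes "(x has_vector_derivative v) (at t within S)"
  shows "((\<lambda>t. (norm (x t))\<^sup>2) has_real_derivative 2 * (x t \<bullet> v)) (at t within S)"
proof -
  have D: "(x has_derivative (\<lambda>h. h *\<^sub>R v)) (at t within S)"
    using assms by (simp add: has_vector_derivative_def)
  have "((\<lambda>t. x t \<bullet> x t) has_derivative (\<lambda>h. x t \<bullet> (h *\<^sub>R v) + (h *\<^sub>R v) \<bullet> x t)) (at t within S)"
    by (rule has_derivative_inner[OF D D])
  moreover have "(\<lambda>h. x t \<bullet> (h *\<^sub>R v) + (h *\<^sub>R v) \<bullet> x t) = (*) (2 * (x t \<bullet> v))"
    by (auto simp: inner_commute)
  ultimately show ?thesis
    by (simp add: has_field_derivative_def power2_norm_eq_inner)
qed

lemma solution_on_components: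
  assumes "solution_on X I x" "t \<in> I"
  shows "((\<lambda>t. fst (x t)) has_vector_derivative fst (X (x t))) (at t within I)"
    and "((\<lambda>t. snd (x t)) has_vector_derivative snd (X (x t))) (at t within I)"
  using assms unfolding solution_on_def
  by (auto intro: bounded_linear.has_vector_derivative[OF bounded_linear_fst]
      bounded_linear.has_vector_derivative[OF bounded_linear_snd])

lemma solution_on_continuous: "solution_on X I x \<Longrightarrow> continuous_on I x"
  unfolding solution_on_def
  by (auto intro: continuous_on_vector_derivative)

lemma solution_on_subset: "solution_on X I x \<Longrightarrow> J \<subseteq> I \<Longrightarrow> solution_on X J x"
  unfolding solution_on_def by (meson has_vector_derivative_within_subset subset_iff)

text \<open>Differentiability within a larger set \<open>I\<close> lets one statement serve
  half-lines and compact intervals; at the endpoints only continuity matters.\<close>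

lemma nondecreasing_if_deriv_nonneg:
  fixes V :: "real \<Rightarrow> real"
  assumes "s \<le> t" "{s..t} \<subseteq> I"
    and D: "\<And>r. r \<in> {s..t} \<Longrightarrow> (V has_real_derivative V' r) (at r within I)"
    and nonneg: "\<And>r. s < r \<Longrightarrow> r < t \<Longrightarrow> V' r \<ge> 0"
  shows "V s \<le> V t"
proof (rule DERIV_nonneg_imp_increasing_open[OF assms(1)])
  have D': "(V has_real_derivative V' r) (at r within {s..t})" if "r \<in> {s..t}" for r
    using D[OF that] assms(2) by (rule has_field_derivative_subset)
  then show "continuous_on {s..t} V" by (rule DERIV_continuous_on)
  show "\<exists>y. (V has_real_derivative y) (at r) \<and> 0 \<le> y" if "s < r" "r < t" for r
    using D'[of r] nonneg that by (auto simp: at_within_Icc_at)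
qed

text \<open>Up to the first time at which \<open>V\<close> is not positive, V exp(-ct) is
  nondecreasing, so that time cannot occur. The inequality is assumed only where \<open>V\<close> is
  nonnegative because the cone estimates hold only inside the cone; \<open>c\<close> may have any
  sign.\<close>

lemma positive_if_deriv_ge:
  fixes V :: "real \<Rightarrow> real"
  assumes D: "\<And>t. t \<ge> 0 \<Longrightarrow> (V has_real_derivative V' t) (at t within {0..})"
    and le: "\<And>t. t \<ge> 0 \<Longrightarrow> V t \<ge> 0 \<Longrightarrow> V' t \<ge> c * V t"
    and pos: "V 0 > 0" and t: "t \<ge> 0"
  shows "V t > 0"
proof (rule ccontr)
  assume neg: "\<not> V t > 0"
  have contV: "continuous_on {0..} V" by (rule DERIV_continuous_on) (use D in auto)
  \<comment> \<open>The times at which \<open>V\<close> is not positive: a closed set, so its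
    infimum is attained.\<close>
  define Z where "Z = {0..t} \<inter> V -` {..0}"
  have "closed Z" unfolding Z_def
    by (rule continuous_closed_preimage) (auto intro: continuous_on_subset[OF contV])
  moreover have "Z \<noteq> {}" "bdd_below Z" using neg t by (auto simp: Z_def)
  ultimately have mem: "Inf Z \<in> Z" by (rule closed_contains_Inf[rotated -1])
  define s where "s = Inf Z"
  have s: "0 \<le> s" "V s \<le> 0" using mem by (auto simp: Z_def s_def)
  have before: "V r > 0" if "0 \<le> r" "r < s" for r
  proof (rule ccontr)
    assume "\<not> V r > 0"
    then have "r \<in> Z" using that mem by (auto simp: Z_def s_def)
    then have "s \<le> r" unfolding s_def using \<open>bdd_below Z\<close> by (rule cInf_lower)
    then show False using that by simp
  qed
  have "V 0 * exp (- c * 0) \<le> V s * exp (- c * s)"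
  proof (rule nondecreasing_if_deriv_nonneg[OF s(1), of "{0..}"])
    show "((\<lambda>t. V t * exp (- c * t)) has_real_derivative (V' r - c * V r) * exp (- c * r)) (at r within {0..})"
      if "r \<in> {0..s}" for r
      using D[of r] that by (auto intro!: derivative_eq_intros simp: algebra_simps)
    show "0 \<le> (V' r - c * V r) * exp (- c * r)" if "0 < r" "r < s" for r
      using le[of r] before[of r] that by simp
  qed auto
  moreover have "V s * exp (- c * s) \<le> 0" using s by (simp add: mult_nonpos_nonneg)
  ultimately show False using pos by simp
qed

text \<open>Gronwall: with L a Lipschitz constant on a ball containing both compact trajectories,
  the squared distance times exp(-2Lt) is nonincreasing and starts at 0.\<close>

lemma solution_unique:
  fixes X :: "'a::euclidean_space \<Rightarrow> 'a"
  assumes lip: "\<And>R. \<exists>L\<ge>0. \<forall>z z'. norm z \<le> R \<longrightarrow> norm z' \<le> R \<longrightarrow> norm (X z - X z') \<le> L * norm (z - z')"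
    and x: "solution_on X {0..d} x" and y: "solution_on X {0..d} y"
    and init: "x 0 = y 0" and t: "t \<in> {0..d}"
  shows "x t = y t"
proof -
  have "bounded (x ` {0..d} \<union> y ` {0..d})"
    using x y by (auto intro!: compact_imp_bounded compact_continuous_image solution_on_continuous)
  then obtain R where R: "\<And>t. t \<in> {0..d} \<Longrightarrow> norm (x t) \<le> R" "\<And>t. t \<in> {0..d} \<Longrightarrow> norm (y t) \<le> R"
    unfolding bounded_iff by (metis UnCI image_eqI)
  obtain L where L: "L \<ge> 0" "\<And>z z'. norm z \<le> R \<Longrightarrow> norm z' \<le> R \<Longrightarrow> norm (X z - X z') \<le> L * norm (z - z')"
    using lip[of R] by blast
  define u where "u t = (norm (x t - y t))\<^sup>2" for t
  have D: "(u has_real_derivative 2 * ((x r - y r) \<bullet> (X (x r) - X (y r)))) (at r within {0..d})"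
    if "r \<in> {0..d}" for r
    unfolding u_def using x y that unfolding solution_on_def
    by (intro has_real_derivative_norm_power2 has_vector_derivative_diff) auto
  have "- (u 0 * exp (- (2 * L) * 0)) \<le> - (u t * exp (- (2 * L) * t))"
  proof (rule nondecreasing_if_deriv_nonneg[of 0 t "{0..d}"])
    let ?u' = "\<lambda>r. 2 * ((x r - y r) \<bullet> (X (x r) - X (y r)))"
    show "((\<lambda>t. - (u t * exp (- (2 * L) * t))) has_real_derivative (2 * L * u r - ?u' r) * exp (- (2 * L) * r))
        (at r within {0..d})" if "r \<in> {0..t}" for r
      using D[of r] that t by (auto intro!: derivative_eq_intros simp: algebra_simps)
    show "0 \<le> (2 * L * u r - ?u' r) * exp (- (2 * L) * r)" if "0 < r" "r < t" for r
    proof -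
      have "(x r - y r) \<bullet> (X (x r) - X (y r)) \<le> norm (x r - y r) * norm (X (x r) - X (y r))"
        by (rule norm_cauchy_schwarz)
      also have "\<dots> \<le> norm (x r - y r) * (L * norm (x r - y r))"
        using that t by (intro mult_left_mono L R) auto
      also have "\<dots> = L * u r" by (simp add: u_def power2_eq_square)
      finally show ?thesis by simp
    qed
  qed (use t in auto)
  then have "u t \<le> 0" using init by (simp add: u_def mult_le_0_iff)
  then show ?thesis by (simp add: u_def)
qed

section \<open>Time shifts and concatenation of solutions\<close>

lemma solution_on_shift:
  assumes x: "solution_on X I x" and J: "\<And>t. t \<in> J \<Longrightarrow> t + s \<in> I"
  shows "solution_on X J (\<lambda>t. x (t + s))"
  unfolding solution_on_def
proof
  fix t assume t: "t \<in> J"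
  have shift: "((\<lambda>t. t + s) has_vector_derivative 1) (at t within J)"
    by (auto intro!: derivative_eq_intros)
  have "(x has_vector_derivative X (x (t + s))) (at (t + s) within (\<lambda>t. t + s) ` J)"
    using solution_on_subset[OF x, of "(\<lambda>t. t + s) ` J"] J t unfolding solution_on_def by blast
  from vector_diff_chain_within[OF shift this]
  show "((\<lambda>t. x (t + s)) has_vector_derivative X (x (t + s))) (at t within J)"
    by (simp add: o_def)
qed

text \<open>Prepends the arc of \<open>x\<close> over the times from \<open>s\<close> to 0 to the
  forward solution \<open>y\<close> and restarts the clock at 0. At the junction t = -s the two
  one-sided derivatives agree, both being \<open>X\<close> at the common point.\<close>

lemma solution_on_glue:
  assumes x: "solution_on X {s..0} x" and y: "solution_on X {0..} y" and init: "x 0 = y 0" and s: "s \<le> 0"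
  shows "solution_on X {0..} (\<lambda>t. if t \<in> {0..- s} then x (t + s) else y (t + s))"
  unfolding solution_on_def
proof
  fix t :: real assume t: "t \<in> {0..}"
  have x': "solution_on X {0..- s} (\<lambda>t. x (t + s))" and y': "solution_on X {- s..} (\<lambda>t. y (t + s))"
    by (rule solution_on_shift[OF x] solution_on_shift[OF y], simp)+
  have "((\<lambda>t. if t \<in> {0..- s} then x (t + s) else y (t + s)) has_vector_derivative
      (if t \<in> {0..- s} then X (x (t + s)) else X (y (t + s)))) (at t within {0..})"
  proof (rule has_vector_derivative_If_within_closures)
    have cl: "{0..- s} \<union> (closure {0..- s} \<inter> closure {- s..}) = {0..- s}"
      "{- s..} \<union> (closure {0..- s} \<inter> closure {- s..}) = {- s..}"
      using s by auto
    show "((\<lambda>t. x (t + s)) has_vector_derivative X (x (t + s)))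
        (at t within {0..- s} \<union> (closure {0..- s} \<inter> closure {- s..}))"
      if "t \<in> {0..- s} \<union> (closure {0..- s} \<inter> closure {- s..})"
      using that x' unfolding solution_on_def cl by blast
    show "((\<lambda>t. y (t + s)) has_vector_derivative X (y (t + s)))
        (at t within {- s..} \<union> (closure {0..- s} \<inter> closure {- s..}))"
      if "t \<in> {- s..} \<union> (closure {0..- s} \<inter> closure {- s..})"
      using that y' unfolding solution_on_def cl by blast
    show "t \<in> {0..- s} \<union> {- s..}" "{0..} = {0..- s} \<union> {- s..}" using t s by auto
    show "x (t + s) = y (t + s)" "X (x (t + s)) = X (y (t + s))"
      if "t \<in> closure {0..- s}" "t \<in> closure {- s..}"
    proof -
      have "t = - s" using that by simp
      then show "x (t + s) = y (t + s)" "X (x (t + s)) = X (y (t + s))" using init by auto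
    qed
  qed
  then show "((\<lambda>t. if t \<in> {0..- s} then x (t + s) else y (t + s)) has_vector_derivative
      X (if t \<in> {0..- s} then x (t + s) else y (t + s))) (at t within {0..})"
    by (simp only: if_distrib[of X])
qed

lemma local_stable_forward:
  assumes y: "solution_on X {0..} y" "\<forall>t\<ge>0. y t \<in> N" "(y \<longlongrightarrow> p) at_top" and s: "s \<ge> 0"
  shows "y s \<in> local_stable X N p"
proof -
  have "((\<lambda>t. y (t + s)) \<longlongrightarrow> p) at_top"
    by (rule filterlim_compose[OF y(3)])
      (rule filterlim_tendsto_add_at_top[OF tendsto_const filterlim_ident, of s, unfolded add.commute[of s]])
  moreover have "solution_on X {0..} (\<lambda>t. y (t + s))"
    by (rule solution_on_shift[OF y(1)]) (use s in auto)
  ultimately show ?thesis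
    unfolding local_stable_def using y(2) s by (auto intro!: exI[of _ "\<lambda>t. y (t + s)"])
qed

text \<open>An arc inside \<open>N\<close> followed by a convergent orbit inside \<open>N\<close> is
  again such an orbit.\<close>

lemma local_stable_backward:
  assumes x: "solution_on X {s..0} x" "\<forall>t\<in>{s..0}. x t \<in> N" and s: "s \<le> 0"
    and stable: "x 0 \<in> local_stable X N p"
  shows "x s \<in> local_stable X N p"
proof -
  obtain y where y: "solution_on X {0..} y" "y 0 = x 0" "\<forall>t\<ge>0. y t \<in> N" "(y \<longlongrightarrow> p) at_top"
    using stable unfolding local_stable_def by auto
  let ?w = "\<lambda>t. if t \<in> {0..- s} then x (t + s) else y (t + s)"
  have "solution_on X {0..} ?w"
    using x(1) y s by (intro solution_on_glue) auto
  moreover have "\<forall>t\<ge>0. ?w t \<in> N" using x(2) y(3) by auto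
  moreover have "((\<lambda>t. y (t + s)) \<longlongrightarrow> p) at_top"
    by (rule filterlim_compose[OF y(4)])
      (rule filterlim_tendsto_add_at_top[OF tendsto_const filterlim_ident, of s, unfolded add.commute[of s]])
  then have "(?w \<longlongrightarrow> p) at_top"
    by (rule Lim_transform_eventually) (rule eventually_mono[OF eventually_gt_at_top[of "- s"]], auto)
  ultimately show ?thesis
    unfolding local_stable_def using s by (auto intro!: exI[of _ ?w])
qed


section \<open>The local stable set in the cone field\<close>

text \<open>While the difference of two solutions lies in the cone \<open>q \<le> M p\<close>, its expanding component
  \<open>p\<close> does not decrease.  The cone is forward invariant, so a pair of solutions that starts in it
  cannot have a common limit.\<close>

lemma cone_estimate:
  fixes p q \<xi> l G M :: real
  assumes M: "M > 0" and "l < \<xi>" "G \<ge> 0" and q: "0 \<le> q" "q \<le> M * p"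
  shows "\<xi> * p\<^sup>2 - (l * q\<^sup>2 + G * q * (p - q / M)) / M\<^sup>2 \<ge> (\<xi> - G / M) * (p\<^sup>2 - q\<^sup>2 / M\<^sup>2)"
proof -
  \<comment> \<open>In this scale the cone is r \<le> p and the quadratic form is p^2 - r^2.\<close>
  define r where "r = q / M"
  have qr: "q = M * r" using M by (simp add: r_def)
  have r: "0 \<le> r" "r \<le> p" using M q by (auto simp: r_def field_simps)
  have "(l * q\<^sup>2 + G * q * (p - q / M)) / M\<^sup>2 = l * r\<^sup>2 + G / M * (r * (p - r))"
    using M by (simp add: qr power2_eq_square field_simps)
  moreover have "q\<^sup>2 / M\<^sup>2 = r\<^sup>2" by (simp add: r_def power_divide)
  moreover have "G / M * (r * (p - r)) \<le> G / M * (p\<^sup>2 - r\<^sup>2)"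
  proof (rule mult_left_mono)
    \<comment> \<open>The excess of the cross term shares the factor p - r with p^2 - r^2, so it is
      a multiple of the quadratic form itself.\<close>
    have "r * (p - r) \<le> (p + r) * (p - r)" using r by (intro mult_right_mono) auto
    then show "r * (p - r) \<le> p\<^sup>2 - r\<^sup>2" by (simp add: power2_eq_square algebra_simps)
  qed (use assms in auto)
  moreover have "l * r\<^sup>2 \<le> \<xi> * r\<^sup>2" using assms by (intro mult_right_mono) auto
  ultimately show ?thesis by (simp add: algebra_simps)
qed

text \<open>\<open>l\<close> is meant to be \<open>mu_ss\<close>, whose weight 1/M fits pairs on the
  boundary of the cone. The term with \<open>G\<close> pays for the pairs inside and vanishes on the
  boundary.\<close>

locale cone_field =
  fixes X :: "('u::euclidean_space \<times> 's::euclidean_space) \<Rightarrow> 'u \<times> 's" and B :: "('u \<times> 's) set"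
    and M \<xi> l G :: real
  assumes M_pos: "M > 0" and \<xi>_pos: "\<xi> > 0" and l_less: "l < \<xi>" and G_nonneg: "G \<ge> 0"
    and expansion: "\<lbrakk>z \<in> B; z' \<in> B; norm (snd z - snd z') \<le> M * norm (fst z - fst z')\<rbrakk> \<Longrightarrow>
      \<xi> * (norm (fst z - fst z'))\<^sup>2 \<le> (fst z - fst z') \<bullet> (fst (X z) - fst (X z'))"
    and contraction: "\<lbrakk>z \<in> B; z' \<in> B; norm (snd z - snd z') \<le> M * norm (fst z - fst z')\<rbrakk> \<Longrightarrow>
      (snd z - snd z') \<bullet> (snd (X z) - snd (X z')) \<le> l * (norm (snd z - snd z'))\<^sup>2
        + G * norm (snd z - snd z') * (norm (fst z - fst z') - norm (snd z - snd z') / M)"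
begin

lemma local_stable_lipschitz:
  assumes "z \<in> local_stable X B p" "z' \<in> local_stable X B p"
  shows "norm (fst z - fst z') \<le> norm (snd z - snd z') / M"
proof (rule ccontr)
  assume neg: "\<not> norm (fst z - fst z') \<le> norm (snd z - snd z') / M"
  obtain x where x: "solution_on X {0..} x" "x 0 = z" "\<And>t. t \<ge> 0 \<Longrightarrow> x t \<in> B" "(x \<longlongrightarrow> p) at_top"
    using assms(1) unfolding local_stable_def by auto
  obtain y where y: "solution_on X {0..} y" "y 0 = z'" "\<And>t. t \<ge> 0 \<Longrightarrow> y t \<in> B" "(y \<longlongrightarrow> p) at_top"
    using assms(2) unfolding local_stable_def by auto
  define a b where "a t = fst (x t) - fst (y t)" and "b t = snd (x t) - snd (y t)" for t
  define a' b' where "a' t = fst (X (x t)) - fst (X (y t))" and "b' t = snd (X (x t)) - snd (X (y t))" for t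
  \<comment> \<open>Positive exactly on the open cone ||\<Delta>b|| < M ||\<Delta>a||, where the
    negated claim places the pair at time 0.\<close>
  define V where "V t = (norm (a t))\<^sup>2 - (norm (b t))\<^sup>2 / M\<^sup>2" for t
  have Da: "((\<lambda>t. (norm (a t))\<^sup>2) has_real_derivative 2 * (a t \<bullet> a' t)) (at t within {0..})"
    and Db: "((\<lambda>t. (norm (b t))\<^sup>2) has_real_derivative 2 * (b t \<bullet> b' t)) (at t within {0..})"
    if "t \<ge> 0" for t
    unfolding a_def a'_def b_def b'_def using x(1) y(1) that
    by (auto intro!: has_real_derivative_norm_power2 has_vector_derivative_diff solution_on_components)
  have DV: "(V has_real_derivative 2 * (a t \<bullet> a' t - (b t \<bullet> b' t) / M\<^sup>2)) (at t within {0..})"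
    if "t \<ge> 0" for t
    unfolding V_def
    using DERIV_diff[OF Da[OF that] DERIV_cdivide[OF Db[OF that], of "M\<^sup>2"]] by (simp add: right_diff_distrib)
  have cone_iff: "norm (b t) \<le> M * norm (a t) \<longleftrightarrow> V t \<ge> 0" for t
  proof -
    have "V t \<ge> 0 \<longleftrightarrow> (norm (b t))\<^sup>2 \<le> (M * norm (a t))\<^sup>2"
      using M_pos by (simp add: V_def power_mult_distrib field_simps)
    also have "\<dots> \<longleftrightarrow> norm (b t) \<le> M * norm (a t)"
      using M_pos by (intro power_mono_iff) auto
    finally show ?thesis by simp
  qed
  have "V 0 > 0"
  proof -
    have "norm (b 0) / M < norm (a 0)" using neg x(2) y(2) by (simp add: a_def b_def)
    then have "(norm (b 0) / M)\<^sup>2 < (norm (a 0))\<^sup>2" using M_pos by (intro power_strict_mono) auto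
    then show ?thesis by (simp add: V_def power_divide)
  qed
  have pos: "V t > 0" if "t \<ge> 0" for t
  proof (rule positive_if_deriv_ge[OF DV _ \<open>V 0 > 0\<close> that])
    fix t :: real assume t: "t \<ge> 0" "V t \<ge> 0"
    then have cone: "norm (b t) \<le> M * norm (a t)" by (simp add: cone_iff)
    have ea: "\<xi> * (norm (a t))\<^sup>2 \<le> a t \<bullet> a' t"
      using expansion[OF x(3) y(3), of t t] t cone by (simp add: a_def a'_def b_def)
    have eb: "b t \<bullet> b' t \<le> l * (norm (b t))\<^sup>2 + G * norm (b t) * (norm (a t) - norm (b t) / M)"
      using contraction[OF x(3) y(3), of t t] t cone by (simp add: a_def b_def b'_def)
    \<comment> \<open>This factor may be negative when \<open>G\<close> is large; preservation of
      positivity does not depend on its sign.\<close>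
    have "2 * (\<xi> - G / M) * V t = 2 * ((\<xi> - G / M) * V t)" by simp
    also have "\<dots> \<le> 2 * (\<xi> * (norm (a t))\<^sup>2
        - (l * (norm (b t))\<^sup>2 + G * norm (b t) * (norm (a t) - norm (b t) / M)) / M\<^sup>2)"
      unfolding V_def
      by (rule mult_left_mono[OF cone_estimate[OF M_pos l_less G_nonneg norm_ge_zero cone]]) simp
    also have "\<dots> \<le> 2 * (a t \<bullet> a' t - (b t \<bullet> b' t) / M\<^sup>2)"
      by (intro mult_left_mono diff_mono ea divide_right_mono[OF eb]) simp_all
    finally show "2 * (\<xi> - G / M) * V t \<le> 2 * (a t \<bullet> a' t - (b t \<bullet> b' t) / M\<^sup>2)" .
  qed
  have mono: "(norm (a 0))\<^sup>2 \<le> (norm (a t))\<^sup>2" if t: "t \<ge> 0" for t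
  proof (rule nondecreasing_if_deriv_nonneg[OF t, of "{0..}"])
    fix r :: real assume r: "0 < r" "r < t"
    then have "norm (b r) \<le> M * norm (a r)" using pos[of r] by (simp add: cone_iff)
    then have "\<xi> * (norm (a r))\<^sup>2 \<le> a r \<bullet> a' r"
      using expansion[OF x(3) y(3), of r r] r by (simp add: a_def a'_def b_def)
    moreover have "\<xi> * (norm (a r))\<^sup>2 \<ge> 0" using \<xi>_pos by simp
    ultimately show "0 \<le> 2 * (a r \<bullet> a' r)" by linarith
  qed (use Da in auto)
  have "((\<lambda>t. (norm (a t))\<^sup>2) \<longlongrightarrow> (norm (fst p - fst p))\<^sup>2) at_top"
    unfolding a_def by (intro tendsto_intros x(4) y(4))
  moreover have "\<forall>\<^sub>F t in at_top. (norm (a 0))\<^sup>2 \<le> (norm (a t))\<^sup>2"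
    using eventually_ge_at_top[of 0] by eventually_elim (rule mono)
  ultimately have "(norm (a 0))\<^sup>2 \<le> (norm (fst p - fst p))\<^sup>2"
    by (rule tendsto_lowerbound) simp
  then have "a 0 = 0" by simp
  then show False using neg x(2) y(2) M_pos by (simp add: a_def)
qed

text \<open>Along a solution in the local stable set the difference quotients inherit the Lipschitz bound.\<close>

lemma local_stable_velocity:
  assumes "z \<in> local_stable X B p"
  shows "norm (fst (X z)) \<le> norm (snd (X z)) / M"
proof -
  obtain y where y: "solution_on X {0..} y" "y 0 = z" "\<forall>t\<ge>0. y t \<in> B" "(y \<longlongrightarrow> p) at_top"
    using assms unfolding local_stable_def by auto
  have "(y has_vector_derivative X z) (at 0 within {0..})"
    using y(1,2) unfolding solution_on_def by force
  then have lim: "((\<lambda>t. (1 / t) *\<^sub>R (y t - z)) \<longlongrightarrow> X z) (at_right 0)"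
  proof -
    have "((\<lambda>t. (1 / norm (t - 0)) *\<^sub>R (y t - (y 0 + (t - 0) *\<^sub>R X z))) \<longlongrightarrow> 0) (at 0 within {0..})"
      using \<open>(y has_vector_derivative X z) _\<close> unfolding has_vector_derivative_def has_derivative_within by simp
    then have "((\<lambda>t. (1 / norm (t - 0)) *\<^sub>R (y t - (y 0 + (t - 0) *\<^sub>R X z))) \<longlongrightarrow> 0) (at_right 0)"
      by (rule tendsto_within_subset) auto
    then have "((\<lambda>t. (1 / t) *\<^sub>R (y t - z) - X z) \<longlongrightarrow> 0) (at_right 0)"
      by (rule Lim_transform_eventually)
        (auto simp: eventually_at_filter y(2) algebra_simps)
    then show ?thesis by (rule LIM_zero_cancel)
  qed
  show ?thesis
  proof (rule tendsto_le[OF _ tendsto_divide[OF tendsto_norm[OF tendsto_snd[OF lim]] tendsto_const]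
        tendsto_norm[OF tendsto_fst[OF lim]]])
    \<comment> \<open>The orbit of \<open>z\<close> stays in the local stable set, so the Lipschitz
      bound applies to the pair \<open>y t\<close>, \<open>z\<close>.\<close>
    have "norm (fst (y t - z)) \<le> norm (snd (y t - z)) / M" if "t > 0" for t
      using local_stable_lipschitz[OF local_stable_forward[OF y(1,3,4)] assms, of t] that by simp
    then have "norm (fst ((1 / t) *\<^sub>R (y t - z))) \<le> norm (snd ((1 / t) *\<^sub>R (y t - z))) / M" if "t > 0" for t
      using that mult_left_mono[of "norm (fst (y t - z))" "norm (snd (y t - z)) / M" "1 / t"] by auto
    then show "\<forall>\<^sub>F t in at_right 0. norm (fst ((1 / t) *\<^sub>R (y t - z))) \<le> norm (snd ((1 / t) *\<^sub>R (y t - z))) / M"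
      by (auto simp: eventually_at_filter)
  qed (use M_pos in auto)
qed

end

section \<open>Decrease along the local stable set\<close>

locale lyapunov_cone_field = cone_field X B M \<xi> l G
  for X :: "('u::euclidean_space \<times> 's::euclidean_space) \<Rightarrow> 'u \<times> 's" and B M \<xi> l G +
  fixes \<rho> :: real
  assumes B_eq: "B = cball 0 1 \<times> cball 0 1" and M_gt: "M > 1" and \<rho>_neg: "\<rho> < 0"
    and equilibrium: "X (0, 0) = (0, 0)"
    and lipschitz: "\<exists>L\<ge>0. \<forall>z z'. norm z \<le> R \<longrightarrow> norm z' \<le> R \<longrightarrow> norm (X z - X z') \<le> L * norm (z - z')"
    and rate: "\<lbrakk>z \<in> B; norm (fst z) \<le> norm (snd z) / M\<rbrakk> \<Longrightarrow>
      snd z \<bullet> snd (X z) + norm (snd z) * norm (snd (X z)) / M\<^sup>2 \<le> \<rho> * (norm (snd z))\<^sup>2"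
begin

abbreviation Ws where "Ws \<equiv> local_stable X B (0, 0)"

lemma Ws_subset: "Ws \<subseteq> B"
  unfolding local_stable_def by auto

lemma zero_in_Ws: "(0, 0) \<in> Ws"
proof -
  have "solution_on X {0..} (\<lambda>_. (0, 0))"
    unfolding solution_on_def using has_vector_derivative_const[of "(0, 0)"]
    by (auto simp: equilibrium zero_prod_def)
  then show ?thesis
    unfolding local_stable_def by (auto intro!: exI[of _ "\<lambda>_. (0, 0)"] simp: B_eq)
qed

lemma Ws_cone: "z \<in> Ws \<Longrightarrow> norm (fst z) \<le> norm (snd z) / M"
  using local_stable_lipschitz[OF _ zero_in_Ws] by simp

text \<open>The slope bounds for position and velocity, relative to the equilibrium, each contribute
  a factor 1/M; this is the origin of the 1/M^2 in \<open>rate\<close>. The first inequality gives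
  the decay of \<open>L\<close>, the second shows that solutions move inward where ||b|| =
  1.\<close>

lemma Ws_decrease:
  assumes z: "z \<in> Ws"
  shows "z \<bullet> X z \<le> \<rho> * (norm (snd z))\<^sup>2" and "snd z \<bullet> snd (X z) \<le> \<rho> * (norm (snd z))\<^sup>2"
proof -
  have r: "snd z \<bullet> snd (X z) + norm (snd z) * norm (snd (X z)) / M\<^sup>2 \<le> \<rho> * (norm (snd z))\<^sup>2"
    using rate Ws_subset z Ws_cone by blast
  have "fst z \<bullet> fst (X z) \<le> norm (fst z) * norm (fst (X z))" by (rule norm_cauchy_schwarz)
  also have "\<dots> \<le> (norm (snd z) / M) * (norm (snd (X z)) / M)"
    using M_pos by (intro mult_mono Ws_cone[OF z] local_stable_velocity[OF z]) auto
  also have "\<dots> = norm (snd z) * norm (snd (X z)) / M\<^sup>2" by (simp add: power2_eq_square)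
  finally show "z \<bullet> X z \<le> \<rho> * (norm (snd z))\<^sup>2"
    using r by (simp add: inner_prod_def)
  have "norm (snd z) * norm (snd (X z)) / M\<^sup>2 \<ge> 0" by simp
  then show "snd z \<bullet> snd (X z) \<le> \<rho> * (norm (snd z))\<^sup>2" using r by linarith
qed

text \<open>Membership in \<open>Ws\<close> only provides some solution that stays in
  \<open>B\<close>; uniqueness identifies it with the given one.\<close>

lemma Ws_forward:
  assumes x: "solution_on X {0..d} x" "x 0 \<in> Ws" and t: "t \<in> {0..d}"
  shows "x t \<in> Ws"
proof -
  obtain y where y: "solution_on X {0..} y" "y 0 = x 0" "\<forall>t\<ge>0. y t \<in> B" "(y \<longlongrightarrow> (0, 0)) at_top"
    using x(2) unfolding local_stable_def by auto
  have "solution_on X {0..d} y" by (rule solution_on_subset[OF y(1)]) auto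
  then have "x t = y t" using y(2) by (intro solution_unique[OF lipschitz x(1) _ _ t]) auto
  then show ?thesis using local_stable_forward[OF y(1,3,4), of t] t by simp
qed

text \<open>The stable set touches the boundary of \<open>B\<close> only where \<open>\<parallel>b\<parallel> = 1\<close>, and there the solution
  comes from outside of \<open>B\<close>.\<close>

lemma Ws_locally_invariant:
  assumes d: "0 \<le> d1" "0 < d2" and x: "solution_on X {- d1..d2} x" "x 0 \<in> Ws"
  obtains e where "e > 0" "\<And>t. t \<in> {- d1..d2} \<Longrightarrow> \<bar>t\<bar> < e \<Longrightarrow> x t \<in> B \<Longrightarrow> x t \<in> Ws"
proof -
  have forward: "x t \<in> Ws" if "t \<in> {0..d2}" for t
    by (rule Ws_forward[OF solution_on_subset[OF x(1)] x(2) that]) (use d in auto)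
  have "norm (snd (x 0)) \<le> 1" using x(2) Ws_subset by (auto simp: B_eq)
  then consider "norm (snd (x 0)) < 1" | "norm (snd (x 0)) = 1" by linarith
  then show thesis
  proof cases
    case 1
    \<comment> \<open>Since M > 1, ||a|| \<le> ||b||/M \<le> ||b|| < 1. The point is thus interior
      to \<open>B\<close>, and short backward arcs stay in \<open>B\<close>.\<close>
    have "norm (fst (x 0)) < 1"
    proof -
      have "norm (snd (x 0)) / M \<le> norm (snd (x 0)) / 1" using M_gt by (intro divide_left_mono) auto
      then show ?thesis using Ws_cone[OF x(2)] 1 by simp
    qed
    then have "x 0 \<in> ball 0 1 \<times> ball 0 1" using 1 by (simp add: mem_Times_iff)
    moreover have "(x \<longlongrightarrow> x 0) (at 0 within {- d1..d2})"
      using solution_on_continuous[OF x(1)] d by (auto simp: continuous_on_def)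
    ultimately have "\<forall>\<^sub>F t in at 0 within {- d1..d2}. x t \<in> ball 0 1 \<times> ball 0 1"
      by (intro topological_tendstoD) (auto intro: open_Times)
    then obtain e where e: "e > 0" "\<And>t. t \<in> {- d1..d2} \<Longrightarrow> t \<noteq> 0 \<Longrightarrow> dist t 0 < e \<Longrightarrow> x t \<in> ball 0 1 \<times> ball 0 1"
      unfolding eventually_at by blast
    have inB: "x t \<in> B" if "t \<in> {- d1..d2}" "\<bar>t\<bar> < e" for t
      using e(2)[of t] that x(2) Ws_subset by (cases "t = 0") (auto simp: B_eq mem_Times_iff)
    have "x t \<in> Ws" if t: "t \<in> {- d1..d2}" "\<bar>t\<bar> < e" for t
    proof (cases "t \<ge> 0")
      case True
      then show ?thesis using forward t by simp
    next
      case False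
      show ?thesis
        by (rule local_stable_backward[OF solution_on_subset[OF x(1)] _ _ x(2)])
          (use False t d inB in auto)
    qed
    with e(1) that show thesis by blast
  next
    case 2
    have "2 * (snd (x 0) \<bullet> snd (X (x 0))) < 0"
      using Ws_decrease(2)[OF x(2)] 2 \<rho>_neg by simp
    moreover have "((\<lambda>t. (norm (snd (x t)))\<^sup>2) has_real_derivative 2 * (snd (x 0) \<bullet> snd (X (x 0))))
        (at 0 within {- d1..d2})"
      using d by (intro has_real_derivative_norm_power2 solution_on_components(2)[OF x(1)]) auto
    ultimately obtain e where e: "e > 0" "\<And>h. h > 0 \<Longrightarrow> 0 - h \<in> {- d1..d2} \<Longrightarrow> h < e \<Longrightarrow>
        (norm (snd (x 0)))\<^sup>2 < (norm (snd (x (0 - h))))\<^sup>2"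
      using has_real_derivative_neg_dec_left by blast
    \<comment> \<open>For negative times the premise \<open>x t \<in> B\<close> is contradictory,
      since ||b|| exceeds 1 there.\<close>
    have "x t \<in> Ws" if t: "t \<in> {- d1..d2}" "\<bar>t\<bar> < e" "x t \<in> B" for t
    proof (cases "t \<ge> 0")
      case True
      then show ?thesis using forward t by simp
    next
      case False
      then have "1 < (norm (snd (x t)))\<^sup>2" using e(2)[of "- t"] t 2 by simp
      moreover have "norm (snd (x t)) \<le> 1" using t(3) by (auto simp: B_eq)
      ultimately show ?thesis using power_le_one[of "norm (snd (x t))" 2] by simp
    qed
    with e(1) that show thesis by blast
  qed
qed

lemma lyapunov:
  assumes graph: "Ws = {(\<sigma> b, b) |b. b \<in> cball 0 1}"
  shows "lyapunov_on X (0, 0) B (\<lambda>(a, b). (norm (\<sigma> b))\<^sup>2 + (norm b)\<^sup>2) Ws"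
  unfolding lyapunov_on_def
proof (intro allI impI, elim conjE)
  fix x d1 d2
  assume d: "0 \<le> d1" "0 < d2" and x: "solution_on X {- d1..d2} x" "x 0 \<in> Ws"
  let ?T = "{t \<in> {- d1..d2}. x t \<in> B}" and ?L = "\<lambda>(a, b). (norm (\<sigma> b))\<^sup>2 + (norm b)\<^sup>2"
  obtain e where e: "e > 0" "\<And>t. t \<in> {- d1..d2} \<Longrightarrow> \<bar>t\<bar> < e \<Longrightarrow> x t \<in> B \<Longrightarrow> x t \<in> Ws"
    using Ws_locally_invariant[OF d x] by blast
  have L: "(norm z)\<^sup>2 = ?L z" if "z \<in> Ws" for z
    using that unfolding graph by (auto simp: norm_Pair)
  have "((\<lambda>t. (norm (x t))\<^sup>2) has_real_derivative 2 * (x 0 \<bullet> X (x 0))) (at 0 within {- d1..d2})"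
    using x(1) d unfolding solution_on_def by (intro has_real_derivative_norm_power2) auto
  then have "((\<lambda>t. (norm (x t))\<^sup>2) has_real_derivative 2 * (x 0 \<bullet> X (x 0))) (at 0 within ?T)"
    by (rule has_field_derivative_subset) auto
  \<comment> \<open>At the times in \<open>?T\<close> closer to 0 than \<open>e\<close> the solution
    lies in \<open>Ws\<close>, where \<open>?L\<close> is the squared norm. The derivative transfers
    without differentiating \<open>\<sigma>\<close>.\<close>
  then have D: "((\<lambda>t. ?L (x t)) has_real_derivative 2 * (x 0 \<bullet> X (x 0))) (at 0 within ?T)"
    by (rule has_field_derivative_transform_within[OF _ e(1)])
      (use d x(2) Ws_subset e(2) L in \<open>auto simp: dist_real_def\<close>)
  have dec: "x 0 \<bullet> X (x 0) \<le> \<rho> * (norm (snd (x 0)))\<^sup>2" by (rule Ws_decrease(1)[OF x(2)])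
  also have "\<dots> \<le> 0" using \<rho>_neg by (simp add: mult_nonpos_nonneg)
  finally have "2 * (x 0 \<bullet> X (x 0)) \<le> 0" by simp
  \<comment> \<open>A vanishing derivative forces b = 0, and the cone around the origin then forces
    a = 0.\<close>
  moreover have "x 0 = (0, 0)" if "2 * (x 0 \<bullet> X (x 0)) = 0"
  proof -
    have "0 \<le> \<rho> * (norm (snd (x 0)))\<^sup>2" using dec that by simp
    then have "snd (x 0) = 0" using \<rho>_neg by (simp add: zero_le_mult_iff)
    moreover from this have "fst (x 0) = 0" using Ws_cone[OF x(2)] by simp
    ultimately show ?thesis by (simp add: prod_eq_iff)
  qed
  ultimately show "\<exists>L'. ((\<lambda>t. ?L (x t)) has_real_derivative L') (at 0 within ?T) \<and>
      L' \<le> 0 \<and> (L' = 0 \<longrightarrow> x 0 = (0, 0))"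
    using D by blast
qed

end

section \<open>Estimates from the cone condition\<close>

lemma SUP_upper_triple:
  fixes h :: "'a \<Rightarrow> 'b \<Rightarrow> 'c \<Rightarrow> real"
  assumes "\<And>a b \<mu>. (a, b) \<in> B \<Longrightarrow> \<mu> \<in> K \<Longrightarrow> h a b \<mu> \<le> C" "(a, b) \<in> B" "\<mu> \<in> K"
  shows "h a b \<mu> \<le> (SUP ((a, b), \<mu>)\<in>B \<times> K. h a b \<mu>)"
proof -
  have "bdd_above ((\<lambda>((a, b), \<mu>). h a b \<mu>) ` (B \<times> K))"
    by (rule bdd_aboveI2[where M = C]) (use assms(1) in auto)
  from cSUP_upper[OF _ this, of "((a, b), \<mu>)"] show ?thesis using assms(2,3) by simp
qed

lemma INF_lower_triple:
  fixes h :: "'a \<Rightarrow> 'b \<Rightarrow> 'c \<Rightarrow> real"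
  assumes "\<And>a b \<mu>. (a, b) \<in> B \<Longrightarrow> \<mu> \<in> K \<Longrightarrow> C \<le> h a b \<mu>" "(a, b) \<in> B" "\<mu> \<in> K"
  shows "(INF ((a, b), \<mu>)\<in>B \<times> K. h a b \<mu>) \<le> h a b \<mu>"
proof -
  have "bdd_below ((\<lambda>((a, b), \<mu>). h a b \<mu>) ` (B \<times> K))"
    by (rule bdd_belowI2[where m = C]) (use assms(1) in auto)
  from cINF_lower[OF this, of "((a, b), \<mu>)"] show ?thesis using assms(2,3) by simp
qed

lemma inner_le_onorm:
  fixes A :: "'a::real_normed_vector \<Rightarrow> 'b::real_inner"
  assumes "bounded_linear A"
  shows "\<bar>w \<bullet> A v\<bar> \<le> norm w * (onorm A * norm v)"
proof -
  have "\<bar>w \<bullet> A v\<bar> \<le> norm w * norm (A v)" by (rule Cauchy_Schwarz_ineq2)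
  also have "\<dots> \<le> norm w * (onorm A * norm v)" by (intro mult_left_mono onorm[OF assms]) simp
  finally show ?thesis .
qed

text \<open>Tested against \<Delta>a, the diagonal block contributes at least the infimum in
  \<open>xi_u\<close>. The cone bounds the cross term by M times the supremum there, times
  ||\<Delta>a||^2. These extrema are separate in \<open>xi_u\<close>, so each can be inserted on its
  own.\<close>

lemma expansion_estimate:
  fixes f :: "'u::euclidean_space \<Rightarrow> 's::euclidean_space \<Rightarrow> 'k::euclidean_space \<Rightarrow> 'u"
  assumes f: "smooth_family f \<Lambda>" and B: "compact B" "convex B" and K: "compact K" "K \<subseteq> \<Lambda>" "\<mu> \<in> K"
    and M: "M > 0" and z: "z \<in> B" "z' \<in> B" and cone: "norm (snd z - snd z') \<le> M * norm (fst z - fst z')"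
  shows "xi_u f M B K * (norm (fst z - fst z'))\<^sup>2 \<le>
    (fst z - fst z') \<bullet> (f (fst z) (snd z) \<mu> - f (fst z') (snd z') \<mu>)"
proof -
  interpret smooth_family f \<Lambda> by (rule f)
  define m where "m = (INF ((a, b), \<mu>)\<in>B \<times> K. log_min (D_a f a b \<mu>))"
  define n where "n = (SUP ((a, b), \<mu>)\<in>B \<times> K. onorm (D_b\<mu> f a b \<mu>))"
  obtain c where c: "\<And>a b \<mu>. (a, b) \<in> B \<Longrightarrow> \<mu> \<in> K \<Longrightarrow> onorm (J a b \<mu>) \<le> c"
    using onorm_J_bound[OF B(1) K(1,2)] by auto
  have m: "m \<le> log_min (D_a f a b \<mu>)" and n: "onorm (D_b f a b \<mu>) \<le> n" if "(a, b) \<in> B" for a b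
  proof -
    have "- c \<le> log_min (D_a f a b \<nu>)" if "(a, b) \<in> B" "\<nu> \<in> K" for a b \<nu>
    proof -
      have "\<nu> \<in> \<Lambda>" using that K by blast
      then show ?thesis
        using abs_log_min_le_onorm[OF bounded_linear.linear[OF bounded_linear_partials(1)], of \<nu> a b]
          onorm_partials_le(1)[of \<nu> a b] c[OF that] by (simp add: abs_le_iff)
    qed
    from INF_lower_triple[of B K "- c" "\<lambda>a b \<nu>. log_min (D_a f a b \<nu>)", OF this \<open>(a, b) \<in> B\<close> K(3)]
    show "m \<le> log_min (D_a f a b \<mu>)" unfolding m_def by simp
    have "onorm (D_b\<mu> f a b \<nu>) \<le> c" if "(a, b) \<in> B" "\<nu> \<in> K" for a b \<nu>
      using onorm_partials_le(3)[of \<nu> a b] c[OF that] that K by fastforce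
    from SUP_upper_triple[of B K "\<lambda>a b \<nu>. onorm (D_b\<mu> f a b \<nu>)" c, OF this \<open>(a, b) \<in> B\<close> K(3)]
    have "onorm (D_b\<mu> f a b \<mu>) \<le> n" unfolding n_def by simp
    then show "onorm (D_b f a b \<mu>) \<le> n"
      using onorm_partials_le(4)[of \<mu> a b] K by fastforce
  qed
  have \<mu>: "\<mu> \<in> \<Lambda>" using K by blast
  let ?u = "fst z - fst z'" and ?v = "snd z - snd z'"
  obtain a b where ab: "(a, b) \<in> closed_segment (fst z', snd z') (fst z, snd z)"
    "?u \<bullet> (f (fst z) (snd z) \<mu> - f (fst z') (snd z') \<mu>) = ?u \<bullet> (D_a f a b \<mu> ?u + D_b f a b \<mu> ?v)"
    by (rule inner_mean_value[OF \<mu>])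
  have mem: "(a, b) \<in> B"
    using ab(1) closed_segment_subset[OF z(2,1) B(2)] by auto
  note bl = bounded_linear_partials[OF \<mu>, of a b]
  have n0: "n \<ge> 0" using n[OF mem] onorm_pos_le[OF bl(2)] by linarith
  have "m * (norm ?u)\<^sup>2 \<le> log_min (D_a f a b \<mu>) * (norm ?u)\<^sup>2"
    by (intro mult_right_mono m mem) simp
  also have "\<dots> \<le> ?u \<bullet> D_a f a b \<mu> ?u"
    by (rule log_min_le_inner[OF bounded_linear.linear[OF bl(1)]])
  finally have 1: "m * (norm ?u)\<^sup>2 \<le> ?u \<bullet> D_a f a b \<mu> ?u" .
  have "\<bar>?u \<bullet> D_b f a b \<mu> ?v\<bar> \<le> norm ?u * (onorm (D_b f a b \<mu>) * norm ?v)"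
    by (rule inner_le_onorm[OF bl(2)])
  also have "\<dots> \<le> norm ?u * (n * (M * norm ?u))"
    using n0 onorm_pos_le[OF bl(2)] by (intro mult_left_mono mult_mono n mem cone) auto
  finally have "- (M * n * (norm ?u)\<^sup>2) \<le> ?u \<bullet> D_b f a b \<mu> ?v"
    by (simp add: power2_eq_square abs_le_iff mult.commute mult.left_commute)
  with 1 have "(m - M * n) * (norm ?u)\<^sup>2 \<le> ?u \<bullet> (D_a f a b \<mu> ?u + D_b f a b \<mu> ?v)"
    by (simp add: inner_add_right left_diff_distrib)
  then show ?thesis unfolding ab(2) xi_u_def m_def n_def .
qed

text \<open>\<open>G\<close> is a bound for the total derivative on the compact set
  \<open>B \<times> K\<close>, hence uniform in the parameter.\<close>

lemma contraction_estimate: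
  fixes f :: "'u::euclidean_space \<Rightarrow> 's::euclidean_space \<Rightarrow> 'k::euclidean_space \<Rightarrow> 's"
  assumes f: "smooth_family f \<Lambda>" and B: "compact B" "convex B" and K: "compact K" "K \<subseteq> \<Lambda>"
    and M: "M > 0"
  shows "\<exists>G\<ge>0. \<forall>\<mu>\<in>K. \<forall>z\<in>B. \<forall>z'\<in>B. norm (snd z - snd z') \<le> M * norm (fst z - fst z') \<longrightarrow>
    (snd z - snd z') \<bullet> (f (fst z) (snd z) \<mu> - f (fst z') (snd z') \<mu>) \<le>
      mu_ss f M B K * (norm (snd z - snd z'))\<^sup>2
      + G * norm (snd z - snd z') * (norm (fst z - fst z') - norm (snd z - snd z') / M)"
proof -
  interpret smooth_family f \<Lambda> by (rule f)
  obtain c where c: "c \<ge> 0" "\<And>a b \<mu>. (a, b) \<in> B \<Longrightarrow> \<mu> \<in> K \<Longrightarrow> onorm (J a b \<mu>) \<le> c"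
    using onorm_J_bound[OF B(1) K] by auto
  have g: "onorm (D_a f a b \<mu>) \<le> c" if "(a, b) \<in> B" "\<mu> \<in> K" for a b \<mu>
    using onorm_partials_le(1)[of \<mu> a b] c(2)[OF that] that K by fastforce
  have bound: "log_norm (D_b f a b \<mu>) + 1 / M * onorm (D_a f a b \<mu>) \<le> c + 1 / M * c"
    if "(a, b) \<in> B" "\<mu> \<in> K" for a b \<mu>
  proof -
    have \<mu>: "\<mu> \<in> \<Lambda>" using that K by blast
    have "log_norm (D_b f a b \<mu>) \<le> c"
      using abs_log_norm_le_onorm[OF bounded_linear.linear[OF bounded_linear_partials(2)[OF \<mu>]], of a b]
        onorm_partials_le(2)[OF \<mu>, of a b] c(2)[OF that] by (simp add: abs_le_iff)
    then show ?thesis using M g[OF that] by (intro add_mono mult_left_mono) auto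
  qed
  have mu: "log_norm (D_b f a b \<mu>) + 1 / M * onorm (D_a f a b \<mu>) \<le> mu_ss f M B K"
    if "(a, b) \<in> B" "\<mu> \<in> K" for a b \<mu>
    unfolding mu_ss_def
    by (rule SUP_upper_triple[of B K "\<lambda>a b \<mu>. log_norm (D_b f a b \<mu>) + 1 / M * onorm (D_a f a b \<mu>)",
          OF bound that])
  have "(snd z - snd z') \<bullet> (f (fst z) (snd z) \<mu> - f (fst z') (snd z') \<mu>) \<le>
      mu_ss f M B K * (norm (snd z - snd z'))\<^sup>2
      + c * norm (snd z - snd z') * (norm (fst z - fst z') - norm (snd z - snd z') / M)"
    if \<mu>K: "\<mu> \<in> K" and z: "z \<in> B" "z' \<in> B"
      and cone: "norm (snd z - snd z') \<le> M * norm (fst z - fst z')" for \<mu> z z'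
  proof -
    have \<mu>: "\<mu> \<in> \<Lambda>" using K \<mu>K by blast
    let ?u = "fst z - fst z'" and ?v = "snd z - snd z'"
    obtain a b where ab: "(a, b) \<in> closed_segment (fst z', snd z') (fst z, snd z)"
      "?v \<bullet> (f (fst z) (snd z) \<mu> - f (fst z') (snd z') \<mu>) = ?v \<bullet> (D_a f a b \<mu> ?u + D_b f a b \<mu> ?v)"
      by (rule inner_mean_value[OF \<mu>])
    have mem: "(a, b) \<in> B"
      using ab(1) closed_segment_subset[OF z(2,1) B(2)] by auto
    note bl = bounded_linear_partials[OF \<mu>, of a b]
    define l g where "l = log_norm (D_b f a b \<mu>)" and "g = onorm (D_a f a b \<mu>)"
    have diff: "norm ?u - norm ?v / M \<ge> 0" using cone M by (simp add: field_simps)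
    have "?v \<bullet> (D_a f a b \<mu> ?u + D_b f a b \<mu> ?v) \<le> norm ?v * (g * norm ?u) + l * (norm ?v)\<^sup>2"
      unfolding inner_add_right g_def l_def
      using inner_le_onorm[OF bl(1), of ?v ?u] inner_le_log_norm[OF bounded_linear.linear[OF bl(2)], of ?v]
      by linarith
    \<comment> \<open>Splits ||\<Delta>a|| into ||\<Delta>b||/M, which completes the expression
      under the supremum \<open>mu_ss\<close>, and a remainder that is nonnegative in the cone, so
      that \<open>g\<close> may be replaced by its bound.\<close>
    also have "\<dots> = (l + 1 / M * g) * (norm ?v)\<^sup>2 + g * norm ?v * (norm ?u - norm ?v / M)"
      using M by (simp add: power2_eq_square field_simps)
    also have "\<dots> \<le> mu_ss f M B K * (norm ?v)\<^sup>2 + c * norm ?v * (norm ?u - norm ?v / M)"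
      unfolding l_def g_def
      by (intro add_mono mult_right_mono mu g mem \<mu>K diff) auto
    finally show ?thesis unfolding ab(2) .
  qed
  with c(1) show ?thesis by blast
qed

text \<open>Testing \<open>f\<close> against the single vector \<open>b + (\<parallel>b\<parallel> / M\<^sup>2) sgn f\<close> makes the mean value theorem
  produce both terms at the same intermediate point, as the supremum \<open>mu_s_Ws\<close> requires.\<close>

lemma rate_estimate:
  fixes f :: "'u::euclidean_space \<Rightarrow> 's::euclidean_space \<Rightarrow> 'k::euclidean_space \<Rightarrow> 's"
  assumes f: "smooth_family f \<Lambda>" and B: "compact B" "convex B" "(0, 0) \<in> B"
    and K: "compact K" "K \<subseteq> \<Lambda>" "\<mu> \<in> K" and M: "M > 0" and zero: "f 0 0 \<mu> = 0"
    and z: "z \<in> B" "norm (fst z) \<le> norm (snd z) / M"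
  shows "snd z \<bullet> f (fst z) (snd z) \<mu> + norm (snd z) * norm (f (fst z) (snd z) \<mu>) / M\<^sup>2
    \<le> mu_s_Ws f M B K * (norm (snd z))\<^sup>2"
proof -
  interpret smooth_family f \<Lambda> by (rule f)
  obtain c where c: "c \<ge> 0" "\<And>a b \<mu>. (a, b) \<in> B \<Longrightarrow> \<mu> \<in> K \<Longrightarrow> onorm (J a b \<mu>) \<le> c"
    using onorm_J_bound[OF B(1) K(1,2)] by auto
  let ?h = "\<lambda>a b \<mu>. (M^2 + 1) / M^3 * onorm (D_a f a b \<mu>) + 1 / M^2 * mat_m (D_b f a b \<mu>)
      + log_norm (D_b f a b \<mu>)"
  have bound: "?h a b \<nu> \<le> (M^2 + 1) / M^3 * c + 1 / M^2 * c + c"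
    if "(a, b) \<in> B" "\<nu> \<in> K" for a b \<nu>
  proof -
    have \<nu>: "\<nu> \<in> \<Lambda>" using that K by blast
    note lin = bounded_linear.linear[OF bounded_linear_partials(2)[OF \<nu>, of a b]]
    have "onorm (D_a f a b \<nu>) \<le> c" "mat_m (D_b f a b \<nu>) \<le> c" "log_norm (D_b f a b \<nu>) \<le> c"
      using onorm_partials_le(1,2)[OF \<nu>, of a b] mat_m_le_onorm[OF lin]
        abs_le_D1[OF abs_log_norm_le_onorm[OF lin]] c(2)[OF that] by linarith+
    then show ?thesis using M by (intro add_mono mult_left_mono) auto
  qed
  have \<mu>: "\<mu> \<in> \<Lambda>" using K by blast
  define v where "v = f (fst z) (snd z) \<mu>"
  define q where "q = norm (snd z)"
  define w where "w = snd z + (q / M\<^sup>2) *\<^sub>R sgn v"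
  obtain a b where ab: "(a, b) \<in> closed_segment (0, 0) (fst z, snd z)"
    "w \<bullet> (f (fst z) (snd z) \<mu> - f 0 0 \<mu>) = w \<bullet> (D_a f a b \<mu> (fst z - 0) + D_b f a b \<mu> (snd z - 0))"
    by (rule inner_mean_value[OF \<mu>])
  have mem: "(a, b) \<in> B"
    using ab(1) closed_segment_subset[OF B(3) z(1) B(2)] by auto
  note bl = bounded_linear_partials[OF \<mu>, of a b]
  define l g m where "l = log_norm (D_b f a b \<mu>)" and "g = onorm (D_a f a b \<mu>)" and "m = mat_m (D_b f a b \<mu>)"
  have g0: "g \<ge> 0" unfolding g_def by (rule onorm_pos_le[OF bl(1)])
  have q0: "q \<ge> 0" by (simp add: q_def)
  have Da: "norm (D_a f a b \<mu> (fst z)) \<le> g * (q / M)"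
  proof -
    have "norm (D_a f a b \<mu> (fst z)) \<le> g * norm (fst z)" unfolding g_def by (rule onorm[OF bl(1)])
    also have "\<dots> \<le> g * (q / M)" unfolding q_def by (intro mult_left_mono z(2) g0)
    finally show ?thesis .
  qed
  have Db: "norm (D_b f a b \<mu> (snd z)) \<le> m * q"
    unfolding m_def q_def by (rule norm_le_mat_m[OF bounded_linear.linear[OF bl(2)]])
  \<comment> \<open>Also true for v = 0, where \<open>sgn\<close> is 0.\<close>
  have "sgn v \<bullet> v = norm v"
    by (cases "v = 0") (simp_all add: sgn_div_norm power2_norm_eq_inner[symmetric] power2_eq_square)
  then have "snd z \<bullet> v + q * norm v / M\<^sup>2 = w \<bullet> v"
    by (simp add: w_def inner_add_left)
  also have "\<dots> = snd z \<bullet> D_a f a b \<mu> (fst z) + snd z \<bullet> D_b f a b \<mu> (snd z)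
      + q / M\<^sup>2 * (sgn v \<bullet> (D_a f a b \<mu> (fst z) + D_b f a b \<mu> (snd z)))"
    using ab(2) by (simp add: zero v_def[symmetric]) (simp add: w_def inner_add_left inner_add_right distrib_left add_divide_distrib)
  also have "\<dots> \<le> q * (g * (q / M)) + l * q\<^sup>2 + q / M\<^sup>2 * (g * (q / M) + m * q)"
  proof (intro add_mono mult_left_mono)
    have "snd z \<bullet> D_a f a b \<mu> (fst z) \<le> q * norm (D_a f a b \<mu> (fst z))"
      unfolding q_def by (rule norm_cauchy_schwarz)
    also have "\<dots> \<le> q * (g * (q / M))" by (intro mult_left_mono Da q0)
    finally show "snd z \<bullet> D_a f a b \<mu> (fst z) \<le> q * (g * (q / M))" .
    show "snd z \<bullet> D_b f a b \<mu> (snd z) \<le> l * q\<^sup>2"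
      unfolding l_def q_def by (rule inner_le_log_norm[OF bounded_linear.linear[OF bl(2)]])
    let ?s = "D_a f a b \<mu> (fst z) + D_b f a b \<mu> (snd z)"
    have "sgn v \<bullet> ?s \<le> norm (sgn v) * norm ?s" by (rule norm_cauchy_schwarz)
    also have "\<dots> \<le> 1 * norm ?s" by (intro mult_right_mono) (auto simp: norm_sgn)
    also have "\<dots> \<le> g * (q / M) + m * q" using norm_triangle_mono[OF Da Db] by simp
    finally show "sgn v \<bullet> ?s \<le> g * (q / M) + m * q" .
  qed (use q0 in simp)
  \<comment> \<open>(M^2 + 1)/M^3 = 1/M + 1/M^3: the first part comes from testing against b, the
    second from the \<open>sgn\<close> correction of length at most ||b||/M^2; both use ||a|| \<le>
    ||b||/M.\<close>
  also have "\<dots> = ((M^2 + 1) / M^3 * g + 1 / M^2 * m + l) * q\<^sup>2"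
    using M by (simp add: power2_eq_square power3_eq_cube field_simps)
  also have "\<dots> \<le> mu_s_Ws f M B K * q\<^sup>2"
  proof (rule mult_right_mono)
    show "(M^2 + 1) / M^3 * g + 1 / M^2 * m + l \<le> mu_s_Ws f M B K"
      unfolding mu_s_Ws_def l_def g_def m_def
      by (rule SUP_upper_triple[of B K ?h, OF bound mem K(3)])
  qed simp
  finally show ?thesis unfolding v_def q_def .
qed

text \<open>The chain rule for the inverse map gives a left inverse of the derivative. The
  equilibrium is given for the original field \<open>F\<close>; injectivity carries it to the field
  in coordinates.\<close>

lemma diffeomorphism_derivative_inj:
  assumes P: "diffeomorphism P" and "frechet_derivative P (at z) w = 0"
  shows "w = 0"
proof -
  have "P differentiable (at z)" "inv P differentiable (at (P z))" "bij P"
    using P unfolding diffeomorphism_def by (auto intro: smooth_on_differentiable)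
  then have "(inv P \<circ> P has_derivative frechet_derivative (inv P) (at (P z)) \<circ> frechet_derivative P (at z)) (at z)"
    by (intro diff_chain_at) (auto simp: frechet_derivative_works)
  moreover have "inv P \<circ> P = id" using \<open>bij P\<close> by (simp add: bij_is_inj)
  ultimately have "frechet_derivative (inv P) (at (P z)) \<circ> frechet_derivative P (at z) = id"
    using has_derivative_unique has_derivative_id unfolding id_def by metis
  then have "w = frechet_derivative (inv P) (at (P z)) (frechet_derivative P (at z) w)"
    by (metis comp_apply id_apply)
  also have "\<dots> = 0"
    using \<open>inv P differentiable (at (P z))\<close> assms(2) linear_0[OF linear_frechet_derivative] by metis
  finally show ?thesis .
qed

theorem proposition3p14:
  fixes K \<Lambda> :: "(real^'k) set"
    and F :: "real^'n \<Rightarrow> real^'k \<Rightarrow> real^'n"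
    and xstar :: "real^'k \<Rightarrow> real^'n"
    and P :: "real^'k \<Rightarrow> (real^'u) \<times> (real^'s) \<Rightarrow> real^'n"
    and fa :: "real^'u \<Rightarrow> real^'s \<Rightarrow> real^'k \<Rightarrow> real^'u"
    and fb :: "real^'u \<Rightarrow> real^'s \<Rightarrow> real^'k \<Rightarrow> real^'s"
    and N :: "real^'k \<Rightarrow> (real^'n) set"
    and B :: "((real^'u) \<times> (real^'s)) set"
    and M :: real
    and \<sigma> :: "real^'k \<Rightarrow> real^'s \<Rightarrow> real^'u"
  assumes dims: "CARD('u) + CARD('s) = CARD('n)"
    and K: "compact K" "K \<subseteq> \<Lambda>" "open \<Lambda>"
    and F_smooth: "smooth_on (\<lambda>(x, \<mu>). F x \<mu>) (UNIV \<times> \<Lambda>)"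
    and equilibrium: "\<And>\<mu>. \<mu> \<in> K \<Longrightarrow> F (xstar \<mu>) \<mu> = 0"
    and P: "\<And>\<mu>. \<mu> \<in> K \<Longrightarrow> diffeomorphism (P \<mu>)" "\<And>\<mu>. \<mu> \<in> K \<Longrightarrow> P \<mu> (0, 0) = xstar \<mu>"
    and fa_smooth: "smooth_on (\<lambda>((a, b), \<mu>). fa a b \<mu>) (UNIV \<times> \<Lambda>)"
    and fb_smooth: "smooth_on (\<lambda>((a, b), \<mu>). fb a b \<mu>) (UNIV \<times> \<Lambda>)"
    and coords: "\<And>\<mu> a b. \<mu> \<in> K \<Longrightarrow>
      frechet_derivative (P \<mu>) (at (a, b)) (fa a b \<mu>, fb a b \<mu>) = F (P \<mu> (a, b)) \<mu>"
    and N: "\<And>\<mu>. \<mu> \<in> K \<Longrightarrow> h_set (N \<mu>) (inv (P \<mu>))" "\<And>\<mu>. \<mu> \<in> K \<Longrightarrow> xstar \<mu> \<in> N \<mu>"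
    and B: "B = cball 0 1 \<times> cball 0 1"
    and block: "\<And>\<mu>. \<mu> \<in> K \<Longrightarrow> isolating_block (coord_field fa fb \<mu>) B"
    and M: "M > 1"
    and cone: "cone_condition fa fb M B K"
    and Ws_rate: "mu_s_Ws fb M B K < 0"
    and graph: "\<And>\<mu>. \<mu> \<in> K \<Longrightarrow>
      local_stable (coord_field fa fb \<mu>) B (0, 0) = {(\<sigma> \<mu> b, b) | b. b \<in> cball 0 1}"
  shows "\<forall>\<mu>\<in>K. lyapunov_on (coord_field fa fb \<mu>) (0, 0) B
           (\<lambda>(a, b). (norm (\<sigma> \<mu> b))\<^sup>2 + (norm b)\<^sup>2)
           (local_stable (coord_field fa fb \<mu>) B (0, 0))"
proof
  fix \<mu> assume \<mu>: "\<mu> \<in> K"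
  let ?X = "coord_field fa fb \<mu>"
  have \<mu>\<Lambda>: "\<mu> \<in> \<Lambda>" using \<mu> K(2) by blast
  have fa: "smooth_family fa \<Lambda>" and fb: "smooth_family fb \<Lambda>"
    by (rule smooth_family.intro, fact fa_smooth fb_smooth)+
  have B': "compact B" "convex B" "(0, 0) \<in> B"
    unfolding B by (auto intro: compact_Times convex_Times)
  have M0: "M > 0" using M by simp
  have "frechet_derivative (P \<mu>) (at (0, 0)) (fa 0 0 \<mu>, fb 0 0 \<mu>) = 0"
    using coords[OF \<mu>] equilibrium[OF \<mu>] P(2)[OF \<mu>] by simp
  then have zero: "fa 0 0 \<mu> = 0" "fb 0 0 \<mu> = 0"
    using diffeomorphism_derivative_inj[OF P(1)[OF \<mu>]] by (metis Pair_inject zero_prod_def)+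
  obtain G where G: "G \<ge> 0" "\<And>z z'. z \<in> B \<Longrightarrow> z' \<in> B \<Longrightarrow> norm (snd z - snd z') \<le> M * norm (fst z - fst z') \<Longrightarrow>
      (snd z - snd z') \<bullet> (fb (fst z) (snd z) \<mu> - fb (fst z') (snd z') \<mu>) \<le>
        mu_ss fb M B K * (norm (snd z - snd z'))\<^sup>2
        + G * norm (snd z - snd z') * (norm (fst z - fst z') - norm (snd z - snd z') / M)"
    using contraction_estimate[OF fb B'(1,2) K(1,2) M0] \<mu> by meson
  have X: "fst (?X z) = fa (fst z) (snd z) \<mu>" "snd (?X z) = fb (fst z) (snd z) \<mu>" for z
    by (simp_all add: coord_field_def case_prod_unfold)
  have lip: "\<exists>L\<ge>0. \<forall>z z'. norm z \<le> R \<longrightarrow> norm z' \<le> R \<longrightarrow> norm (?X z - ?X z') \<le> L * norm (z - z')" for R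
  proof -
    obtain L L' where L: "L \<ge> 0" "L' \<ge> 0"
      "\<And>z z'. norm z \<le> R \<Longrightarrow> norm z' \<le> R \<Longrightarrow>
        norm (fa (fst z) (snd z) \<mu> - fa (fst z') (snd z') \<mu>) \<le> L * norm (z - z')"
      "\<And>z z'. norm z \<le> R \<Longrightarrow> norm z' \<le> R \<Longrightarrow>
        norm (fb (fst z) (snd z) \<mu> - fb (fst z') (snd z') \<mu>) \<le> L' * norm (z - z')"
      using smooth_family.lipschitz_on_slice[OF fa \<mu>\<Lambda>, of R] smooth_family.lipschitz_on_slice[OF fb \<mu>\<Lambda>, of R]
      by meson
    have "norm (?X z - ?X z') \<le> (L + L') * norm (z - z')" if "norm z \<le> R" "norm z' \<le> R" for z z'
    proof -
      have "norm (?X z - ?X z') \<le> norm (fst (?X z - ?X z')) + norm (snd (?X z - ?X z'))"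
        by (metis norm_Pair_le prod.collapse)
      then show ?thesis
        using L(3,4)[OF that] by (simp add: X distrib_right)
    qed
    then show ?thesis using L(1,2) by (intro exI[of _ "L + L'"]) auto
  qed
  interpret lyapunov_cone_field ?X B M "xi_u fa M B K" "mu_ss fb M B K" G "mu_s_Ws fb M B K"
  proof unfold_locales
    show "?X (0, 0) = (0, 0)" by (simp add: coord_field_def zero)
    show "B = cball 0 1 \<times> cball 0 1" by (rule B)
    show "0 < xi_u fa M B K" "mu_ss fb M B K < xi_u fa M B K"
      using cone unfolding cone_condition_def by auto
  next
    fix z z' assume "z \<in> B" "z' \<in> B" "norm (snd z - snd z') \<le> M * norm (fst z - fst z')"
    then show "xi_u fa M B K * (norm (fst z - fst z'))\<^sup>2 \<le> (fst z - fst z') \<bullet> (fst (?X z) - fst (?X z'))"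
      unfolding X by (rule expansion_estimate[OF fa B'(1,2) K(1,2) \<mu> M0])
  next
    fix z assume "z \<in> B" "norm (fst z) \<le> norm (snd z) / M"
    then show "snd z \<bullet> snd (?X z) + norm (snd z) * norm (snd (?X z)) / M\<^sup>2
        \<le> mu_s_Ws fb M B K * (norm (snd z))\<^sup>2"
      unfolding X by (rule rate_estimate[OF fb B' K(1,2) \<mu> M0 zero(2)])
  qed (use M0 M G Ws_rate lip in \<open>auto simp only: X\<close>)
  show "lyapunov_on ?X (0, 0) B (\<lambda>(a, b). (norm (\<sigma> \<mu> b))\<^sup>2 + (norm b)\<^sup>2) (local_stable ?X B (0, 0))"
    by (rule lyapunov[OF graph[OF \<mu>]])
qed

end
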